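(* Let $M$ be a smooth connected Riemannian manifold without boundary. For any $v\in\mathcal{K}(M)$ and any $\delta>1$ there is a $C(v,\delta)>0$ such that for all $t\ge0$, $$\sup_{x\in M}\mathbb{E}\left[\mathrm{e}^{\int_0^t|v(B_s(x))|\,\mathrm{d}s}\,1_{\{t<\zeta(x)\}}\right]\le\delta\,\mathrm{e}^{tC(v,\delta)}.$$
   Context: $\mathrm{vol}$ is the Riemannian volume measure and $\Delta$ the (nonpositive) Laplace-Beltrami operator. $p(t,x,y)$ is the minimal positive heat kernel of $M$: the pointwise minimal function $(0,\infty)\times M\times M\to(0,\infty)$ such that for each $y$, $p(\cdot,\cdot,y)$ is a classical ($\mathsf{C}^{1,2}$) solution of $\partial_tu=\tfrac12\Delta u$, $\lim_{t\to0+}u(t,\cdot)=\delta_y$. A Borel function $w:M\to\mathbb{C}$ is in the Kato class $\mathcal{K}(M)$ if $$\lim_{t\to0+}\sup_{x\in M}\int_0^t\int_Mp(s,x,y)|w(y)|\,\mathrm{vol}(\mathrm{d}y)\,\mathrm{d}s=0.$$ $(\Omega,\mathscr{F},\mathscr{F}_*,\mathbb{P})$ is a filtered probability space satisfying the usual assumptions and carrying, for each $x\in M$, a Brownian motion $B(x):[0,\zeta(x))\times\Omega\to M$ on $M$ starting at $x$ (the diffusion generated by $\Delta/2$), with lifetime $\zeta(x):\Omega\to[0,\infty]$; in particular $\mathbb{P}\{B_t(x)\in N,\ t<\zeta(x)\}=\int_Np(t,x,y)\,\mathrm{vol}(\mathrm{d}y)$ for Borel $N\subset M$. $\mathbb{E}$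 is the expectation with respect to $\mathbb{P}$. *)

theory Defs
  imports "HOL-Probability.Probability"
begin

section \<open>Smooth functions on open subsets of Euclidean space\<close>

definition partial_deriv :: "'n \<Rightarrow> (real ^ 'n \<Rightarrow> real) \<Rightarrow> real ^ 'n::finite \<Rightarrow> real" where
  "partial_deriv i f z = frechet_derivative f (at z) (axis i 1)"

text \<open>Class \<open>C\<^sup>k\<close> on \<open>S\<close>; only used for open \<open>S\<close>.\<close>

primrec Ck_on :: "nat \<Rightarrow> (real ^ 'n::finite) set \<Rightarrow> (real ^ 'n \<Rightarrow> real) \<Rightarrow> bool" where
  "Ck_on 0 S f \<longleftrightarrow> continuous_on S f"
| "Ck_on (Suc k) S f \<longleftrightarrow> f differentiable_on S \<and> (\<forall>i. Ck_on k S (partial_deriv i f))"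

definition smooth_on :: "(real ^ 'n::finite) set \<Rightarrow> (real ^ 'n \<Rightarrow> real) \<Rightarrow> bool" where
  "smooth_on S f \<longleftrightarrow> (\<forall>k. Ck_on k S f)"


section \<open>Smooth manifolds and Riemannian metrics\<close>

text \<open>
  The manifold \<open>M\<close> is a whole type of Hausdorff, second countable topological spaces; its
  dimension is the cardinality of the index type of the model space. A chart is a pair of its
  domain and its coordinate map. The atlas need not be maximal.
\<close>

type_synonym ('a, 'n) chart = "'a set \<times> ('a \<Rightarrow> real ^ 'n)"

definition coord_inv :: "('a, 'n::finite) chart \<Rightarrow> real ^ 'n \<Rightarrow> 'a" where
  "coord_inv c = inv_into (fst c) (snd c)"

definition is_chart :: "('a::topological_space, 'n::finite) chart \<Rightarrow> bool" where
  "is_chart c \<longleftrightarrow> open (fst c) \<and> open (snd c ` fst c) \<and>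
     homeomorphism (fst c) (snd c ` fst c) (snd c) (coord_inv c)"

definition smooth_atlas :: "('a::topological_space, 'n::finite) chart set \<Rightarrow> bool" where
  "smooth_atlas A \<longleftrightarrow>
     (\<forall>c\<in>A. is_chart c) \<and> (\<Union>c\<in>A. fst c) = UNIV \<and>
     (\<forall>c\<in>A. \<forall>d\<in>A. \<forall>i. smooth_on (snd c ` (fst c \<inter> fst d)) (\<lambda>z. snd d (coord_inv c z) $ i))"

text \<open>
  A covariant 2-tensor field is given by its component matrices: \<open>g c x $ i $ j\<close> is the value
  of the metric at the point \<open>x\<close> on the coordinate vector fields \<open>i\<close> and \<open>j\<close> of the chart \<open>c\<close>.
  The last clause is the transformation law of these components under a change of charts.
\<close>

type_synonym ('a, 'n) metric_tensor = "('a, 'n) chart \<Rightarrow> 'a \<Rightarrow> real ^ 'n ^ 'n"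

definition jacobian_at :: "('a, 'n::finite) chart \<Rightarrow> ('a, 'n) chart \<Rightarrow> 'a \<Rightarrow> real ^ 'n ^ 'n" where
  "jacobian_at c d x = matrix (frechet_derivative (\<lambda>z. snd d (coord_inv c z)) (at (snd c x)))"

definition riemannian_metric ::
    "('a::topological_space, 'n::finite) chart set \<Rightarrow> ('a, 'n) metric_tensor \<Rightarrow> bool" where
  "riemannian_metric A g \<longleftrightarrow>
     (\<forall>c\<in>A. (\<forall>i j. smooth_on (snd c ` fst c) (\<lambda>z. g c (coord_inv c z) $ i $ j)) \<and>
        (\<forall>x\<in>fst c. transpose (g c x) = g c x \<and> (\<forall>\<xi>. \<xi> \<noteq> 0 \<longrightarrow> \<xi> \<bullet> (g c x *v \<xi>) > 0))) \<and>
     (\<forall>c\<in>A. \<forall>d\<in>A. \<forall>x\<in>fst c \<inter> fst d.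
        g c x = transpose (jacobian_at c d x) ** g d x ** jacobian_at c d x)"

definition riemannian_manifold ::
    "('a::{t2_space, second_countable_topology}, 'n::finite) chart set \<Rightarrow>
     ('a, 'n) metric_tensor \<Rightarrow> bool" where
  "riemannian_manifold A g \<longleftrightarrow> smooth_atlas A \<and> riemannian_metric A g"

text \<open>The conditions below determine the Borel measure \<open>vol\<close> uniquely.\<close>

definition riemannian_volume ::
    "('a::topological_space, 'n::finite) chart set \<Rightarrow> ('a, 'n) metric_tensor \<Rightarrow>
     'a measure \<Rightarrow> bool" where
  "riemannian_volume A g vol \<longleftrightarrow> sets vol = sets borel \<and>
     (\<forall>c\<in>A. \<forall>N\<in>sets borel. N \<subseteq> fst c \<longrightarrow>
        emeasure vol N =
          (\<integral>\<^sup>+ z\<in>snd c ` N. ennreal (sqrt (det (g c (coord_inv c z)))) \<partial>lborel))"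

definition chart_laplacian ::
    "('a, 'n::finite) metric_tensor \<Rightarrow> ('a, 'n) chart \<Rightarrow> ('a \<Rightarrow> real) \<Rightarrow> 'a \<Rightarrow> real" where
  "chart_laplacian g c f x =
     (let G = (\<lambda>z. g c (coord_inv c z)) in
      1 / sqrt (det (g c x)) *
      (\<Sum>i\<in>UNIV. \<Sum>j\<in>UNIV.
         partial_deriv i
           (\<lambda>z. sqrt (det (G z)) * matrix_inv (G z) $ i $ j *
                 partial_deriv j (\<lambda>z'. f (coord_inv c z')) z)
           (snd c x)))"

text \<open>For \<open>f\<close> of class \<open>C\<^sup>2\<close> the value does not depend on the chosen chart around \<open>x\<close>.\<close>

definition laplace_beltrami ::
    "('a, 'n::finite) chart set \<Rightarrow> ('a, 'n) metric_tensor \<Rightarrow> ('a \<Rightarrow> real) \<Rightarrow> 'a \<Rightarrow> real" where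
  "laplace_beltrami A g f x = chart_laplacian g (SOME c. c \<in> A \<and> x \<in> fst c) f x"


section \<open>The minimal positive heat kernel\<close>

text \<open>Functions on \<open>(0, \<infinity>) \<times> M\<close> are curried, and their values at times \<open>t \<le> 0\<close> are irrelevant.\<close>

definition C12 ::
    "('a::topological_space, 'n::finite) chart set \<Rightarrow> (real \<Rightarrow> 'a \<Rightarrow> real) \<Rightarrow> bool" where
  "C12 A u \<longleftrightarrow>
     (\<forall>c\<in>A.
        let D = {0<..} \<times> snd c ` fst c;
            w = (\<lambda>t z. u t (coord_inv c z))
        in (\<forall>t>0. Ck_on 2 (snd c ` fst c) (w t)) \<and>
           (\<forall>t>0. \<forall>x\<in>fst c. (\<lambda>s. u s x) differentiable (at t)) \<and>
           continuous_on D (\<lambda>(t, z). w t z) \<and>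
           continuous_on D (\<lambda>(t, z). deriv (\<lambda>s. w s z) t) \<and>
           (\<forall>i. continuous_on D (\<lambda>(t, z). partial_deriv i (w t) z)) \<and>
           (\<forall>i j. continuous_on D (\<lambda>(t, z). partial_deriv i (partial_deriv j (w t)) z)))"

text \<open>The initial condition is convergence of \<open>u t\<close>, as a density with respect to \<open>vol\<close>, to the
  Dirac measure at \<open>y\<close>, tested on continuous functions with compact support.\<close>

definition heat_fundamental_solution ::
    "('a::topological_space, 'n::finite) chart set \<Rightarrow> ('a, 'n) metric_tensor \<Rightarrow>
     'a measure \<Rightarrow> 'a \<Rightarrow> (real \<Rightarrow> 'a \<Rightarrow> real) \<Rightarrow> bool" where
  "heat_fundamental_solution A g vol y u \<longleftrightarrow>
     C12 A u \<and>
     (\<forall>t>0. \<forall>x. deriv (\<lambda>s. u s x) t = 1 / 2 * laplace_beltrami A g (u t) x) \<and>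
     (\<forall>f::'a \<Rightarrow> real. continuous_on UNIV f \<and> (\<exists>K. compact K \<and> (\<forall>x. x \<notin> K \<longrightarrow> f x = 0)) \<longrightarrow>
        ((\<lambda>t. \<integral>x. u t x * f x \<partial>vol) \<longlongrightarrow> f y) (at_right 0))"

definition positive_heat_kernel ::
    "('a::topological_space, 'n::finite) chart set \<Rightarrow> ('a, 'n) metric_tensor \<Rightarrow>
     'a measure \<Rightarrow> (real \<Rightarrow> 'a \<Rightarrow> 'a \<Rightarrow> real) \<Rightarrow> bool" where
  "positive_heat_kernel A g vol p \<longleftrightarrow>
     (\<forall>t>0. \<forall>x y. p t x y > 0) \<and>
     (\<forall>y. heat_fundamental_solution A g vol y (\<lambda>t x. p t x y))"

definition minimal_heat_kernel ::
    "('a::topological_space, 'n::finite) chart set \<Rightarrow> ('a, 'n) metric_tensor \<Rightarrow>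
     'a measure \<Rightarrow> (real \<Rightarrow> 'a \<Rightarrow> 'a \<Rightarrow> real) \<Rightarrow> bool" where
  "minimal_heat_kernel A g vol p \<longleftrightarrow>
     positive_heat_kernel A g vol p \<and>
     (\<forall>q. positive_heat_kernel A g vol q \<longrightarrow> (\<forall>t>0. \<forall>x y. p t x y \<le> q t x y))"


section \<open>The Kato class\<close>

definition kato_class ::
    "'a measure \<Rightarrow> (real \<Rightarrow> 'a \<Rightarrow> 'a \<Rightarrow> real) \<Rightarrow> ('a::topological_space \<Rightarrow> complex) set" where
  "kato_class vol p =
     {w \<in> borel_measurable borel.
        ((\<lambda>t. SUP x. \<integral>\<^sup>+ s\<in>{0..t}.
             (\<integral>\<^sup>+ y. ennreal (p s x y) * ennreal (cmod (w y)) \<partial>vol) \<partial>lborel) \<longlongrightarrow> 0) (at_right 0)}"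


section \<open>Brownian motion\<close>

text \<open>
  Time is indexed by \<open>[0, \<infinity>]\<close>, so that lifetimes are stopping times in the sense of
  the library.
\<close>

definition usual_filtered_prob_space :: "'w measure \<Rightarrow> (ennreal \<Rightarrow> 'w measure) \<Rightarrow> bool" where
  "usual_filtered_prob_space P F \<longleftrightarrow>
     prob_space P \<and> complete_measure P \<and>
     filtration (space P) F \<and> (\<forall>t. sets (F t) \<subseteq> sets P) \<and>
     null_sets P \<subseteq> sets (F 0) \<and>
     (\<forall>t<\<infinity>. sets (F t) = (\<Inter>s\<in>{t<..}. sets (F s)))"

text \<open>
  \<open>X t \<omega>\<close> is meaningful only for \<open>0 \<le> t < \<zeta> \<omega>\<close>. For \<open>p\<close> the minimal positive heat kernel, i.e.
  the integral kernel of the semigroup generated by half the Laplace-Beltrami operator, this is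
  the diffusion generated by that operator: an adapted process with continuous paths which starts
  in \<open>x\<close>, leaves every compact set at its lifetime \<open>\<zeta>\<close> if \<open>\<zeta>\<close> is finite, and has the Markov
  property with respect to the filtration, with transition density \<open>p\<close>. For \<open>s = 0\<close> the last
  clause contains the one-dimensional distributions of \<open>X\<close>.
\<close>

definition brownian_motion ::
    "'a::topological_space measure \<Rightarrow> (real \<Rightarrow> 'a \<Rightarrow> 'a \<Rightarrow> real) \<Rightarrow>
     'w measure \<Rightarrow> (ennreal \<Rightarrow> 'w measure) \<Rightarrow>
     'a \<Rightarrow> (real \<Rightarrow> 'w \<Rightarrow> 'a) \<Rightarrow> ('w \<Rightarrow> ennreal) \<Rightarrow> bool" where
  "brownian_motion vol p P F x X \<zeta> \<longleftrightarrow>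
     stopping_time F \<zeta> \<and>
     (\<forall>t\<ge>0. \<forall>N\<in>sets borel. {\<omega>\<in>space P. ennreal t < \<zeta> \<omega> \<and> X t \<omega> \<in> N} \<in> sets (F (ennreal t))) \<and>
     (AE \<omega> in P. 0 < \<zeta> \<omega> \<and> X 0 \<omega> = x) \<and>
     (AE \<omega> in P. continuous_on {t. 0 \<le> t \<and> ennreal t < \<zeta> \<omega>} (\<lambda>t. X t \<omega>)) \<and>
     (AE \<omega> in P. \<zeta> \<omega> < \<infinity> \<longrightarrow>
        (\<forall>K. compact K \<longrightarrow> (\<exists>s<\<zeta> \<omega>. \<forall>t\<ge>0. s < ennreal t \<and> ennreal t < \<zeta> \<omega> \<longrightarrow> X t \<omega> \<notin> K))) \<and>
     (\<forall>s\<ge>0. \<forall>t>0. \<forall>N\<in>sets borel.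
        AE \<omega> in P.
          nn_cond_exp P (F (ennreal s))
            (indicator {\<omega>\<in>space P. ennreal (s + t) < \<zeta> \<omega> \<and> X (s + t) \<omega> \<in> N}) \<omega> =
          indicator {\<omega>. ennreal s < \<zeta> \<omega>} \<omega> * (\<integral>\<^sup>+ y\<in>N. ennreal (p t (X s \<omega>) y) \<partial>vol))"


section \<open>Exponential of extended nonnegative reals\<close>

definition exp_ennreal :: "ennreal \<Rightarrow> ennreal" where
  "exp_ennreal a = (if a = \<infinity> then \<infinity> else ennreal (exp (enn2real a)))"

end

theory Submission
  imports Defs
begin

text \<open>
  Khasminskii's argument. Let \<open>\<alpha> = 1 - 1/\<delta>\<close> and choose \<open>h > 0\<close> such that
  \<open>E \<integral>\<^sub>0\<^sup>h |v(B\<^sub>r(x))| dr \<le> \<alpha>\<close> for all \<open>x\<close>. By the Markov property this bound also holds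
  conditionally on any past, so integrating successively over
  \<open>s < u\<^sub>1 < \<dots> < u\<^sub>n < s + h\<close> gives \<open>\<alpha>\<^sup>n\<close> for the \<open>n\<close>-th term of the exponential series of
  \<open>\<integral> |v(B\<^sub>u)| du\<close> over \<open>[s, s + h]\<close>. Hence the conditional exponential moment over a time span
  \<open>h\<close> is at most \<open>1/(1 - \<alpha>) = \<delta>\<close>, and splitting \<open>[0, t]\<close> into at most \<open>t/h + 1\<close> such spans
  gives \<open>C = ln \<delta> / h\<close>.
\<close>


subsection \<open>Exponentials and iterated integrals\<close>

text \<open>The obstacle is measurability. For each \<open>y\<close> the kernel
  \<open>p t x y\<close> is regular in \<open>(t, x)\<close>, but nothing is given about its
  dependence on \<open>y\<close>, the variable of integration, while Fubini's theorem needs the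
  semigroup along a path to be measurable in time and \<omega> jointly. The Markov argument
  therefore runs in the locale \<open>killed_markov_family\<close>, where transition probabilities
  are laws of the processes themselves; measurability then comes from path continuity, the Markov
  property and completeness of \<open>P\<close>. The kernel returns only at the end, in a one-sided
  comparison with the Kato integral.

  Conditioning on the past is expressed by arbitrary nonnegative \<open>F s\<close>-measurable
  weights \<open>Z\<close>. A factor that depends on the path up to a later time is absorbed into
  the weight at that time. This drives both the induction over the terms of the series and the one
  over the time spans. The exponential is only bounded above by the series, which is the direction
  required and also covers paths along which the integral is infinite.\<close>

lemma exp_ennreal_simps [simp]:
  "exp_ennreal \<infinity> = \<infinity>" "exp_ennreal top = top" "exp_ennreal 0 = 1"
  "0 \<le> x \<Longrightarrow> exp_ennreal (ennreal x) = ennreal (exp x)"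
  by (auto simp: exp_ennreal_def)

lemma exp_ennreal_add: "exp_ennreal (a + b) = exp_ennreal a * exp_ennreal b"
  by (cases a; cases b)
     (auto simp: exp_add ennreal_mult simp flip: ennreal_plus simp: ennreal_mult_top ennreal_top_mult)

lemma exp_ennreal_mono: "a \<le> b \<Longrightarrow> exp_ennreal a \<le> exp_ennreal b"
  by (cases a; cases b) (auto simp: top_unique)

lemma borel_measurable_exp_ennreal [measurable]: "exp_ennreal \<in> borel_measurable borel"
  unfolding exp_ennreal_def[abs_def] by measurable

text \<open>The recursion removes the smallest time, so the remaining integral depends only on what
  happens after it and can be estimated conditionally on the past of that time.\<close>

primrec iterated_integral :: "(real \<Rightarrow> ennreal) \<Rightarrow> real \<Rightarrow> nat \<Rightarrow> real \<Rightarrow> ennreal" where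
  "iterated_integral a t 0 s = 1"
| "iterated_integral a t (Suc n) s = (\<integral>\<^sup>+u\<in>{s..t}. a u * iterated_integral a t n u \<partial>lborel)"

lemma measurable_iterated_integral_pair:
  assumes [measurable]: "(\<lambda>(u, \<omega>). a u \<omega>) \<in> borel_measurable (borel \<Otimes>\<^sub>M M)"
  shows "(\<lambda>(s, \<omega>). iterated_integral (\<lambda>u. a u \<omega>) t n s) \<in> borel_measurable (borel \<Otimes>\<^sub>M M)"
proof (induction n)
  case (Suc n)
  note [measurable] = Suc
  \<comment> \<open>The moving domain \<open>{s..t}\<close> is written as the section of a fixed
    measurable set of pairs \<open>(s, u)\<close>.\<close>
  have "(\<lambda>(s, \<omega>). \<integral>\<^sup>+u. a u \<omega> * iterated_integral (\<lambda>u. a u \<omega>) t n u * indicator {(s, u). s \<le> u \<and> u \<le> t} (s, u) \<partial>lborel)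
      \<in> borel_measurable (borel \<Otimes>\<^sub>M M)"
    by measurable
  also have "(\<lambda>(s, \<omega>). \<integral>\<^sup>+u. a u \<omega> * iterated_integral (\<lambda>u. a u \<omega>) t n u * indicator {(s, u). s \<le> u \<and> u \<le> t} (s, u) \<partial>lborel)
     = (\<lambda>(s, \<omega>). iterated_integral (\<lambda>u. a u \<omega>) t (Suc n) s)"
    by (auto simp: fun_eq_iff indicator_def intro!: nn_integral_cong)
  finally show ?case .
qed simp

lemma borel_measurable_iterated_integral:
  assumes [measurable]: "a \<in> borel_measurable borel"
  shows "iterated_integral a t n \<in> borel_measurable borel"
proof -
  have "(\<lambda>(u, \<omega>::unit). a u) \<in> borel_measurable (borel \<Otimes>\<^sub>M count_space UNIV)" by measurable
  from measurable_iterated_integral_pair[OF this, of t n]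
  have "(\<lambda>s. (\<lambda>(s, \<omega>). iterated_integral a t n s) (s, ())) \<in> borel_measurable borel"
    by (rule measurable_compose[rotated]) simp
  then show ?thesis by simp
qed

lemma iterated_integral_antimono:
  "s \<le> s' \<Longrightarrow> iterated_integral a t n s' \<le> iterated_integral a t n s"
  by (cases n) (auto intro!: nn_integral_mono simp: indicator_def)

text \<open>The series \<open>S\<close> solves \<open>S s = 1 + \<integral> a u * S u\<close> over \<open>[s, t]\<close> and is antitone.\<close>

lemma iterated_integral_series_ge:
  assumes [measurable]: "a \<in> borel_measurable borel"
  assumes "s \<le> u" "u \<le> t"
  defines "S \<equiv> \<lambda>s. \<Sum>n. iterated_integral a t n s"
  shows "S u * (1 + (\<integral>\<^sup>+r\<in>{s..<u}. a r \<partial>lborel)) \<le> S s"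
proof -
  note [measurable] = borel_measurable_iterated_integral[OF assms(1)]
  have [measurable]: "S \<in> borel_measurable borel" unfolding S_def by measurable
  have S: "S s = 1 + (\<integral>\<^sup>+r\<in>{s..t}. a r * S r \<partial>lborel)" for s
  proof -
    have "S s = (\<Sum>n. iterated_integral a t (n + 1) s) + 1"
      unfolding S_def by (subst suminf_offset[where i=1]) (auto simp: add.commute)
    also have "(\<Sum>n. iterated_integral a t (n + 1) s) =
       (\<integral>\<^sup>+r. (\<Sum>n. a r * iterated_integral a t n r * indicator {s..t} r) \<partial>lborel)"
      by (subst nn_integral_suminf) auto
    also have "\<dots> = (\<integral>\<^sup>+r\<in>{s..t}. a r * S r \<partial>lborel)"
      unfolding S_def by (simp only: ennreal_suminf_cmult ennreal_suminf_multc)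
    finally show ?thesis by (simp add: add.commute)
  qed
  have anti: "S u \<le> S r" if "r \<le> u" for r
    unfolding S_def by (intro suminf_le iterated_integral_antimono that) auto
  have "S u * (1 + (\<integral>\<^sup>+r\<in>{s..<u}. a r \<partial>lborel)) = S u + (\<integral>\<^sup>+r\<in>{s..<u}. S u * a r \<partial>lborel)"
    by (simp add: distrib_left nn_integral_cmult mult.assoc)
  also have "(\<integral>\<^sup>+r\<in>{s..<u}. S u * a r \<partial>lborel) \<le> (\<integral>\<^sup>+r\<in>{s..<u}. a r * S r \<partial>lborel)"
    by (intro nn_integral_mono) (auto simp: indicator_def mult.commute[of "a _"] intro!: mult_right_mono anti)
  also have "S u + (\<integral>\<^sup>+r\<in>{s..<u}. a r * S r \<partial>lborel) =
      1 + (\<integral>\<^sup>+r. a r * S r * indicator {u..t} r + a r * S r * indicator {s..<u} r \<partial>lborel)"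
    by (subst S) (simp add: nn_integral_add add.assoc)
  also have "\<dots> = 1 + (\<integral>\<^sup>+r\<in>{s..t}. a r * S r \<partial>lborel)"
    using assms(2,3) by (intro arg_cong2[where f="(+)"] nn_integral_cong) (auto simp: indicator_def)
  also have "\<dots> = S s" by (rule S[symmetric])
  finally show ?thesis by (simp add: add_left_mono)
qed

text \<open>The intermediate value theorem needs this continuity to find the cut points that split
  the integral into pieces of equal mass.\<close>

lemma continuous_on_nn_integral_Icc:
  fixes a :: "real \<Rightarrow> ennreal"
  assumes [measurable]: "a \<in> borel_measurable borel"
  assumes fin: "(\<integral>\<^sup>+r\<in>{s..t}. a r \<partial>lborel) < \<infinity>"
  shows "continuous_on {s..t} (\<lambda>u. enn2real (\<integral>\<^sup>+r\<in>{u..t}. a r \<partial>lborel))"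
proof -
  \<comment> \<open>\<open>enn2real\<close> turns infinity into 0. As the integral is finite, this
    alters \<open>a\<close> only on a null subset of \<open>{s..t}\<close>.\<close>
  define g where "g = (\<lambda>r. enn2real (a r) * indicator {s..t} r)"
  have [measurable]: "g \<in> borel_measurable borel" unfolding g_def by measurable
  have g0: "0 \<le> g r" for r by (simp add: g_def)
  have ae: "AE r in lborel. a r * indicator {s..t} r \<noteq> \<infinity>"
    using fin by (intro nn_integral_PInf_AE) auto
  have eq: "(\<integral>\<^sup>+r\<in>{u..t}. a r \<partial>lborel) = (\<integral>\<^sup>+r. ennreal (indicator {u..t} r * g r) \<partial>lborel)"
    if "s \<le> u" for u
    using ae by (intro nn_integral_cong_AE, eventually_elim)
      (use that in \<open>auto simp: indicator_def g_def less_top split: if_splits\<close>)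
  have int: "integrable lborel g"
  proof (cases "s \<le> t")
    case True
    have "(\<integral>\<^sup>+r. ennreal (g r) \<partial>lborel) = (\<integral>\<^sup>+r\<in>{s..t}. a r \<partial>lborel)"
      unfolding eq[OF order_refl] by (intro nn_integral_cong) (auto simp: g_def indicator_def)
    then show ?thesis using fin g0 by (intro integrableI_nonneg) auto
  qed (auto simp: g_def)
  have seti: "set_integrable lborel {u..t} g" for u
    unfolding set_integrable_def using int by (intro integrable_mult_indicator) auto
  have "enn2real (\<integral>\<^sup>+r\<in>{u..t}. a r \<partial>lborel) = integral {u..t} g" if "u \<in> {s..t}" for u
  proof -
    have "enn2real (\<integral>\<^sup>+r\<in>{u..t}. a r \<partial>lborel) = (LINT r|lborel. indicator {u..t} r * g r)"
      using that g0 by (subst eq) (auto simp: integral_eq_nn_integral)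
    also have "\<dots> = integral {u..t} g"
      using set_borel_integral_eq_integral(2)[OF seti[of u]] by (simp add: set_lebesgue_integral_def)
    finally show ?thesis .
  qed
  moreover have "continuous_on {s..t} (\<lambda>u. integral {u..t} g)"
    using set_borel_integral_eq_integral(1)[OF seti] by (intro indefinite_integral_continuous_1')
  ultimately show ?thesis by (subst continuous_on_cong[OF refl]) auto
qed

text \<open>
  Cutting \<open>[s, t]\<close> into \<open>m\<close> pieces of equal \<open>a\<close>-mass \<open>L/m\<close> and applying the previous estimate on
  each of them bounds the series below by \<open>(1 + L/m)\<^sup>m\<close>.
\<close>

lemma exp_ennreal_le_iterated_integral_series:
  assumes [measurable]: "a \<in> borel_measurable borel"
  assumes "s \<le> t"
  shows "exp_ennreal (\<integral>\<^sup>+u\<in>{s..t}. a u \<partial>lborel) \<le> (\<Sum>n. iterated_integral a t n s)"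
proof (cases "(\<integral>\<^sup>+u\<in>{s..t}. a u \<partial>lborel) = \<infinity>")
  \<comment> \<open>The term for \<open>n = 1\<close> is the integral itself, so the series is
    infinite as well.\<close>
  case True
  have "(\<integral>\<^sup>+u\<in>{s..t}. a u \<partial>lborel) = iterated_integral a t 1 s" by simp
  also have "\<dots> = (\<Sum>n\<in>{1}. iterated_integral a t n s)" by simp
  also have "\<dots> \<le> (\<Sum>n. iterated_integral a t n s)"
    by (intro sum_le_suminf) auto
  finally show ?thesis using True by (simp add: top_unique)
next
  case False
  define S where "S = (\<lambda>s. \<Sum>n. iterated_integral a t n s)"
  define L where "L = (\<lambda>u. enn2real (\<integral>\<^sup>+r\<in>{u..t}. a r \<partial>lborel))"
  have fin: "(\<integral>\<^sup>+r\<in>{u..t}. a r \<partial>lborel) < \<infinity>" if "s \<le> u" for u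
  proof -
    have "(\<integral>\<^sup>+r\<in>{u..t}. a r \<partial>lborel) \<le> (\<integral>\<^sup>+r\<in>{s..t}. a r \<partial>lborel)"
      using that by (intro nn_integral_mono) (auto simp: indicator_def)
    also have "\<dots> < \<infinity>" using False by (simp add: less_top[symmetric])
    finally show ?thesis .
  qed
  have L: "(\<integral>\<^sup>+r\<in>{u..t}. a r \<partial>lborel) = ennreal (L u)" if "s \<le> u" for u
    using fin[OF that] unfolding L_def by simp
  have L0: "0 \<le> L u" for u by (simp add: L_def)
  have Lt: "L t = 0"
  proof -
    have "(\<integral>\<^sup>+r\<in>{t..t}. a r \<partial>lborel) = (\<integral>\<^sup>+r. 0 \<partial>(lborel :: real measure))"
      using AE_lborel_singleton[of t] by (intro nn_integral_cong_AE) (auto simp: indicator_def)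
    then show ?thesis by (simp add: L_def)
  qed
  have step: "S r \<ge> ennreal ((1 + h) ^ m)"
    if "s \<le> r" "r \<le> t" "L r = real m * h" "h > 0" for r h m
    using that
  proof (induction m arbitrary: r)
    case 0
    have "1 = (\<Sum>n\<in>{0}. iterated_integral a t n r)" by simp
    also have "\<dots> \<le> S r" unfolding S_def by (intro sum_le_suminf) auto
    finally show ?case by simp
  next
    case (Suc m)
    have "continuous_on {r..t} L"
      unfolding L_def using fin[OF Suc.prems(1)] by (intro continuous_on_nn_integral_Icc) auto
    \<comment> \<open>The remaining mass \<open>L\<close> runs continuously from
      \<open>(m + 1) * h\<close> at \<open>r\<close> to 0 at \<open>t\<close>. At some
      \<open>u\<close> exactly \<open>m * h\<close> is left, and then \<open>{r..<u}\<close> carries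
      the mass \<open>h\<close>.\<close>
    then obtain u where u: "r \<le> u" "u \<le> t" "L u = real m * h"
      using IVT2'[of L t "real m * h" r] Lt Suc.prems by (auto simp: algebra_simps)
    have "ennreal (L r) = (\<integral>\<^sup>+x. a x * indicator {u..t} x + a x * indicator {r..<u} x \<partial>lborel)"
      using Suc.prems u by (subst L[symmetric]) (auto simp: indicator_def intro!: nn_integral_cong)
    also have "\<dots> = ennreal (L u) + (\<integral>\<^sup>+x\<in>{r..<u}. a x \<partial>lborel)"
      using Suc.prems u by (subst L[symmetric]) (auto simp: nn_integral_add)
    finally have "(\<integral>\<^sup>+x\<in>{r..<u}. a x \<partial>lborel) = ennreal (L r) - ennreal (L u)"
      by simp
    also have "\<dots> = ennreal h"
      using Suc.prems u L0 by (subst ennreal_minus) (auto simp: algebra_simps)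
    finally have h: "(\<integral>\<^sup>+x\<in>{r..<u}. a x \<partial>lborel) = ennreal h" .
    have "ennreal ((1 + h) ^ Suc m) = ennreal ((1 + h) ^ m) * (1 + ennreal h)"
      using \<open>h > 0\<close> by (simp add: ennreal_mult mult.commute flip: ennreal_1 ennreal_plus del: ennreal_1)
    also have "\<dots> \<le> S u * (1 + ennreal h)"
      using Suc u by (intro mult_right_mono) auto
    also have "\<dots> \<le> S r"
      unfolding S_def h[symmetric] using u by (intro iterated_integral_series_ge) auto
    finally show ?case .
  qed
  \<comment> \<open>\<open>step\<close> asks for pieces of positive mass, so zero total mass is
    handled as \<open>m = 0\<close> pieces.\<close>
  have 1: "ennreal ((1 + L s / real n) ^ n) \<le> S s" if "n > 0" for n
  proof (cases "L s = 0")
    case True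
    then show ?thesis using step[of s 0 1] assms by simp
  next
    case False
    then show ?thesis using step[of s n "L s / real n"] assms that L0[of s] by simp
  qed
  have "(\<lambda>n. ennreal ((1 + L s / real n) ^ n)) \<longlonglongrightarrow> ennreal (exp (L s))"
    by (intro tendsto_ennrealI tendsto_exp_limit_sequentially)
  then have "ennreal (exp (L s)) \<le> S s"
    by (rule LIMSEQ_le_const2) (use 1 in \<open>auto intro!: exI[of _ 1]\<close>)
  then show ?thesis using L[of s] L0[of s] by (simp add: S_def)
qed

text \<open>
  The definition of a heat kernel says nothing about measurability of \<open>p t x\<close>, so the integrals
  over \<open>vol\<close> are a priori only lower integrals, for which the next two inequalities are what is
  left of linearity.
\<close>

lemma nn_integral_cmult_le:
  assumes "c < top"
  shows "c * (\<integral>\<^sup>+x. f x \<partial>M) \<le> (\<integral>\<^sup>+x. c * f x \<partial>M)"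
proof -
  have "c * (\<integral>\<^sup>+x. f x \<partial>M) = (SUP g\<in>{g. simple_function M g \<and> g \<le> f}. c * integral\<^sup>S M g)"
    unfolding nn_integral_def by (rule SUP_mult_left_ennreal)
  also have "\<dots> \<le> (\<integral>\<^sup>+x. c * f x \<partial>M)"
  proof (rule SUP_least)
    fix g assume g: "g \<in> {g. simple_function M g \<and> g \<le> f}"
    then have "c * integral\<^sup>S M g = integral\<^sup>S M (\<lambda>x. c * g x)" by simp
    also have "\<dots> \<le> (\<integral>\<^sup>+x. c * f x \<partial>M)"
      unfolding nn_integral_def using g
      by (intro SUP_upper) (auto simp: le_fun_def intro!: mult_left_mono)
    finally show "c * integral\<^sup>S M g \<le> (\<integral>\<^sup>+x. c * f x \<partial>M)" .
  qed
  finally show ?thesis .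
qed

lemma nn_integral_superadd:
  "(\<integral>\<^sup>+x. f x \<partial>M) + (\<integral>\<^sup>+x. g x \<partial>M) \<le> (\<integral>\<^sup>+x. f x + g x \<partial>M)"
proof -
  let ?S = "\<lambda>f. {h. simple_function M h \<and> h \<le> f}"
  have ne: "?S f \<noteq> {}" for f :: "'a \<Rightarrow> ennreal"
    by (auto intro!: exI[of _ "\<lambda>_. 0"] simp: le_fun_def)
  have "(\<integral>\<^sup>+x. f x \<partial>M) + (\<integral>\<^sup>+x. g x \<partial>M) = (SUP h\<in>?S f. integral\<^sup>S M h + (\<integral>\<^sup>+x. g x \<partial>M))"
    unfolding nn_integral_def[of M f] by (subst ennreal_SUP_add_left[OF ne]) simp
  also have "\<dots> \<le> (\<integral>\<^sup>+x. f x + g x \<partial>M)"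
  proof (rule SUP_least)
    fix h assume h: "h \<in> ?S f"
    have "integral\<^sup>S M h + (\<integral>\<^sup>+x. g x \<partial>M) = (SUP k\<in>?S g. integral\<^sup>S M h + integral\<^sup>S M k)"
      unfolding nn_integral_def[of M g] by (subst ennreal_SUP_add_right[OF ne]) simp
    also have "\<dots> \<le> (\<integral>\<^sup>+x. f x + g x \<partial>M)"
    proof (rule SUP_least)
      fix k assume k: "k \<in> ?S g"
      have "integral\<^sup>S M h + integral\<^sup>S M k = integral\<^sup>S M (\<lambda>x. h x + k x)" using h k by simp
      also have "\<dots> \<le> (\<integral>\<^sup>+x. f x + g x \<partial>M)"
        unfolding nn_integral_def using h k
        by (intro SUP_upper) (auto simp: le_fun_def intro!: add_mono)
      finally show "integral\<^sup>S M h + integral\<^sup>S M k \<le> (\<integral>\<^sup>+x. f x + g x \<partial>M)" .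
    qed
    finally show "integral\<^sup>S M h + (\<integral>\<^sup>+x. g x \<partial>M) \<le> (\<integral>\<^sup>+x. f x + g x \<partial>M)" .
  qed
  finally show ?thesis .
qed

subsection \<open>Regular spaces and right limits of paths\<close>

text \<open>A small closed coordinate ball around \<open>x\<close> has a compact image in the
  manifold, which is closed by the Hausdorff property and contains the closure of the open ball.
  Regularity is what allows events about open sets to be recovered from nearby later times.\<close>

lemma riemannian_manifold_regular:
  fixes A :: "('a::t2_space, 'n::finite) chart set" and x :: 'a
  assumes "smooth_atlas A" "open U" "x \<in> U"
  shows "\<exists>V. open V \<and> x \<in> V \<and> closure V \<subseteq> U"
proof -
  obtain c where c: "c \<in> A" "x \<in> fst c" "is_chart c"
    using assms(1) unfolding smooth_atlas_def by blast
  then have hom: "homeomorphism (fst c) (snd c ` fst c) (snd c) (coord_inv c)"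
    and o: "open (fst c)" "open (snd c ` fst c)"
    by (auto simp: is_chart_def)
  have inv: "coord_inv c (snd c y) = y" if "y \<in> fst c" for y
    using hom that by (auto simp: homeomorphism_def)
  have "openin (top_of_set (snd c ` fst c)) (snd c ` (fst c \<inter> U))"
    using hom assms(2) by (intro homeomorphism_imp_open_map[OF hom]) auto
  then have "open (snd c ` (fst c \<inter> U))"
    using o openin_open_trans by blast
  then obtain e where e: "e > 0" "cball (snd c x) e \<subseteq> snd c ` (fst c \<inter> U)"
    using c assms(3) open_contains_cball by blast
  let ?V = "coord_inv c ` ball (snd c x) e" and ?K = "coord_inv c ` cball (snd c x) e"
  have sub: "cball (snd c x) e \<subseteq> snd c ` fst c" using e by auto
  have "openin (top_of_set (fst c)) ?V"
    using sub by (intro homeomorphism_imp_open_map[OF homeomorphism_symD[OF hom]] open_subset) auto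
  then have "open ?V" using o openin_open_trans by blast
  moreover have "compact ?K"
    using hom sub by (intro compact_continuous_image continuous_on_subset[OF homeomorphism_cont2[OF hom]]) auto
  then have "closure ?V \<subseteq> ?K"
    by (intro closure_minimal compact_imp_closed) auto
  moreover have "?K \<subseteq> U" using e inv by fastforce
  moreover have "x \<in> ?V" using e inv c by (metis centre_in_ball image_eqI)
  ultimately show ?thesis by blast
qed

text \<open>This carries measurability over from a conditional expectation to an explicit expression
  that agrees with it almost everywhere.\<close>

lemma (in complete_measure) borel_measurable_ennreal_AE:
  fixes f g :: "'a \<Rightarrow> ennreal"
  assumes [measurable]: "f \<in> borel_measurable M" and eq: "AE x in M. f x = g x"
  shows "g \<in> borel_measurable M"
proof (rule borel_measurableI_greater)
  fix y
  have "AE x in M. x \<in> {x \<in> space M. y < f x} \<longleftrightarrow> x \<in> {x \<in> space M. y < g x}"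
    using eq by eventually_elim auto
  then show "{x \<in> space M. y < g x} \<in> sets M"
    by (rule in_sets_AE) auto
qed

text \<open>The sets are finite unions of basic open sets whose closures lie in \<open>U\<close>.
  Finiteness keeps the closure of the union inside \<open>U\<close>, and regularity makes the basic
  sets cover \<open>U\<close>.\<close>

lemma regular_open_exhaustion:
  fixes U :: "'a::second_countable_topology set"
  assumes reg: "\<And>x. x \<in> U \<Longrightarrow> \<exists>V. open V \<and> x \<in> V \<and> closure V \<subseteq> U"
  obtains V :: "nat \<Rightarrow> 'a set"
  where "\<And>m. open (V m)" "\<And>m. closure (V m) \<subseteq> U" "incseq V" "(\<Union>m. V m) = U"
proof -
  obtain B :: "'a set set" where B: "countable B" "topological_basis B"
    using ex_countable_basis by blast
  \<comment> \<open>The empty set is inserted so that \<open>from_nat_into\<close> enumerates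
    exactly \<open>C\<close> even if no basic set qualifies.\<close>
  define C where "C = insert {} {W\<in>B. closure W \<subseteq> U}"
  have C: "countable C" "C \<noteq> {}" using B by (auto simp: C_def)
  then have rng: "range (from_nat_into C) = C" by (rule range_from_nat_into[rotated])
  have Cp: "open W" "closure W \<subseteq> U" if "W \<in> C" for W
    using that B topological_basis_open by (auto simp: C_def)
  define V where "V m = (\<Union>i\<le>m. from_nat_into C i)" for m
  have mem: "from_nat_into C i \<in> C" for i using rng by blast
  have "closure (V m) \<subseteq> U" for m
  proof -
    have "closure (V m) \<subseteq> (\<Union>i\<le>m. closure (from_nat_into C i))"
      unfolding V_def by (intro closure_minimal UN_mono order_refl closure_subset closed_UN) auto
    also have "\<dots> \<subseteq> U" by (intro UN_least Cp(2) mem)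
    finally show ?thesis .
  qed
  moreover have "open (V m)" for m unfolding V_def by (intro open_UN ballI Cp(1) mem)
  moreover have "incseq V" unfolding V_def incseq_def by (intro allI impI UN_mono) auto
  moreover have "(\<Union>m. V m) = U"
  proof
    have "V m \<subseteq> U" for m
      unfolding V_def by (intro UN_least order_trans[OF closure_subset Cp(2)] mem)
    then show "(\<Union>m. V m) \<subseteq> U" by blast
    show "U \<subseteq> (\<Union>m. V m)"
    proof
      fix x assume "x \<in> U"
      then obtain V' where V': "open V'" "x \<in> V'" "closure V' \<subseteq> U" using reg by blast
      obtain W where W: "W \<in> B" "x \<in> W" "W \<subseteq> V'"
        by (rule topological_basisE[OF B(2) V'(1,2)])
      have "closure W \<subseteq> U" using closure_mono[OF W(3)] V'(3) by (rule order_trans)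
      then have "W \<in> range (from_nat_into C)" unfolding rng using W(1) by (simp add: C_def)
      then obtain i where "W = from_nat_into C i" by (rule rangeE)
      then have "x \<in> V i" using W by (auto simp: V_def)
      then show "x \<in> (\<Union>m. V m)" by blast
    qed
  qed
  ultimately show ?thesis using that[of V] by blast
qed

text \<open>Approaching from the right is essential: a path that is dead at \<open>u\<close> is dead
  at every \<open>e n\<close>, whereas times to the left of \<open>u\<close> might still be before
  the lifetime. The gap between \<open>V\<close> and \<open>U\<close> compensates for the fact that
  a path outside an open set may enter it immediately afterwards.\<close>

lemma path_right_limit:
  fixes Y :: "real \<Rightarrow> 'a::topological_space"
  assumes cont: "continuous_on {t. 0 \<le> t \<and> ennreal t < T} Y"
    and e: "\<And>n. u \<le> e n" "e \<longlonglongrightarrow> u" and u: "0 \<le> u"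
  shows path_right_limit_open:
      "ennreal u < T \<Longrightarrow> Y u \<in> V \<Longrightarrow> open V \<Longrightarrow> \<forall>\<^sub>F n in sequentially. ennreal (e n) < T \<and> Y (e n) \<in> V"
    and path_right_limit_closure:
      "\<not> (ennreal u < T \<and> Y u \<in> U) \<Longrightarrow> closure V \<subseteq> U \<Longrightarrow>
        \<forall>\<^sub>F n in sequentially. \<not> (ennreal (e n) < T \<and> Y (e n) \<in> V)"
proof -
  have *: "\<forall>\<^sub>F n in sequentially. ennreal (e n) < T" "(\<lambda>n. Y (e n)) \<longlonglongrightarrow> Y u" if T: "ennreal u < T"
  proof -
    have "(\<lambda>n. ennreal (e n)) \<longlonglongrightarrow> ennreal u" by (intro tendsto_ennrealI e)
    then show ev: "\<forall>\<^sub>F n in sequentially. ennreal (e n) < T" using T by (rule order_tendstoD)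
    have "\<forall>\<^sub>F n in sequentially. e n \<in> {t. 0 \<le> t \<and> ennreal t < T}"
      using ev by eventually_elim (use e(1) u order_trans in auto)
    then show "(\<lambda>n. Y (e n)) \<longlonglongrightarrow> Y u"
      using u T e by (intro continuous_on_tendsto_compose[OF cont]) auto
  qed
  { assume "ennreal u < T" "Y u \<in> V" "open V"
    then show "\<forall>\<^sub>F n in sequentially. ennreal (e n) < T \<and> Y (e n) \<in> V"
      by (intro eventually_conj topological_tendstoD[OF *(2)] *(1)) }
  assume H: "\<not> (ennreal u < T \<and> Y u \<in> U)" "closure V \<subseteq> U"
  show "\<forall>\<^sub>F n in sequentially. \<not> (ennreal (e n) < T \<and> Y (e n) \<in> V)"
  proof (cases "ennreal u < T")
    case True
    then have "Y u \<in> - closure V" using H by auto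
    then have "\<forall>\<^sub>F n in sequentially. Y (e n) \<in> - closure V"
      using *(2)[OF True] by (intro topological_tendstoD) auto
    then show ?thesis by eventually_elim (use closure_subset in auto)
  next
    case False
    then have "\<not> ennreal (e n) < T" for n
      using e(1)[of n] by (meson ennreal_leI le_less_trans)
    then show ?thesis by simp
  qed
qed

text \<open>For \<open>0 \<le> u\<close> this is the smallest multiple of \<open>1 / (n + 1)\<close>
  strictly above \<open>u\<close>. Strictness, and \<open>nat\<close> for negative \<open>u\<close>,
  keep the value positive, as the Markov property is stated only for positive time
  increments.\<close>

definition grid :: "nat \<Rightarrow> real \<Rightarrow> real" where
  "grid n u = (real (nat \<lfloor>real (Suc n) * u\<rfloor>) + 1) / real (Suc n)"

lemma grid_bounds:
  assumes "0 \<le> u"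
  shows "u < grid n u" "grid n u \<le> u + 1 / real (Suc n)"
proof -
  have "0 \<le> real (Suc n) * u" using assms by simp
  then have "real (Suc n) * u < real (nat \<lfloor>real (Suc n) * u\<rfloor>) + 1"
    "real (nat \<lfloor>real (Suc n) * u\<rfloor>) \<le> real (Suc n) * u"
    by linarith+
  then have "u < (real (nat \<lfloor>real (Suc n) * u\<rfloor>) + 1) / real (Suc n)"
    "real (nat \<lfloor>real (Suc n) * u\<rfloor>) / real (Suc n) \<le> u"
    by (simp_all only: less_divide_eq divide_le_eq) (auto simp: algebra_simps)
  then show "u < grid n u" "grid n u \<le> u + 1 / real (Suc n)"
    unfolding grid_def add_divide_distrib by auto
qed

lemma grid_pos: "0 < grid n u"
  unfolding grid_def by (intro divide_pos_pos) auto

lemma grid_tendsto: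
  assumes "0 \<le> u"
  shows "(\<lambda>n. grid n u) \<longlonglongrightarrow> u"
proof (rule tendsto_sandwich[of "\<lambda>_. u" _ _ "\<lambda>n. u + 1 / real (Suc n)"])
  show "(\<lambda>n. u + 1 / real (Suc n)) \<longlonglongrightarrow> u"
    using tendsto_add[OF tendsto_const LIMSEQ_inverse_real_of_nat, of u] by (simp add: inverse_eq_divide)
qed (use grid_bounds[OF assms] in \<open>auto intro!: always_eventually less_imp_le simp del: of_nat_Suc\<close>)

text \<open>As \<open>grid n\<close> takes countably many values, measurability at each fixed time suffices.\<close>

lemma measurable_grid_compose:
  assumes "\<And>r. 0 < r \<Longrightarrow> f r \<in> measurable M N"
  shows "(\<lambda>(u, \<omega>). f (grid n u) \<omega>) \<in> measurable (borel \<Otimes>\<^sub>M M) N"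
proof -
  have "(\<lambda>z. f ((real (nat \<lfloor>real (Suc n) * fst z\<rfloor>) + 1) / real (Suc n)) (snd z))
      \<in> measurable (borel \<Otimes>\<^sub>M M) N"
  proof (rule measurable_compose_countable[where f="\<lambda>k::nat. \<lambda>z. f ((real k + 1) / real (Suc n)) (snd z)"
        and g="\<lambda>z. nat \<lfloor>real (Suc n) * fst z\<rfloor>"])
    show "(\<lambda>z. nat \<lfloor>real (Suc n) * fst z\<rfloor>) \<in> measurable (borel \<Otimes>\<^sub>M M) (count_space UNIV)"
      by measurable
    show "(\<lambda>z. f ((real k + 1) / real (Suc n)) (snd z)) \<in> measurable (borel \<Otimes>\<^sub>M M) N" for k :: nat
      by (rule measurable_compose[OF measurable_snd]) (intro assms divide_pos_pos, auto)
  qed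
  then show ?thesis by (simp add: grid_def split_def)
qed

subsection \<open>Killed Markov families with continuous paths\<close>

text \<open>\<open>T x\<close> is the lifetime of \<open>X x\<close>; for \<open>t \<ge> T x \<omega>\<close> the value \<open>X x t \<omega>\<close> is junk.\<close>

locale killed_markov_family = prob_space P + complete_measure P for P :: "'w measure" +
  fixes F :: "real \<Rightarrow> 'w measure"
    and X :: "'a::{t2_space, second_countable_topology} \<Rightarrow> real \<Rightarrow> 'w \<Rightarrow> 'a"
    and T :: "'a \<Rightarrow> 'w \<Rightarrow> ennreal"
  assumes subalg: "0 \<le> s \<Longrightarrow> subalgebra P (F s)"
    and F_mono: "0 \<le> s \<Longrightarrow> s \<le> t \<Longrightarrow> sets (F s) \<subseteq> sets (F t)"
    and adapted: "0 \<le> t \<Longrightarrow> N \<in> sets borel \<Longrightarrow>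
      {\<omega>\<in>space P. ennreal t < T x \<omega> \<and> X x t \<omega> \<in> N} \<in> sets (F t)"
    and continuous_paths: "\<omega> \<in> space P \<Longrightarrow> continuous_on {t. 0 \<le> t \<and> ennreal t < T x \<omega>} (\<lambda>t. X x t \<omega>)"
    and regular: "open U \<Longrightarrow> (y::'a) \<in> U \<Longrightarrow> \<exists>V. open V \<and> y \<in> V \<and> closure V \<subseteq> U"
    and markov: "0 \<le> s \<Longrightarrow> 0 < t \<Longrightarrow> N \<in> sets borel \<Longrightarrow>
      AE \<omega> in P. nn_cond_exp P (F s) (indicator {\<omega>\<in>space P. ennreal (s + t) < T x \<omega> \<and> X x (s + t) \<omega> \<in> N}) \<omega> =
        indicator {\<omega>. ennreal s < T x \<omega>} \<omega> *
        emeasure P {\<omega>'\<in>space P. ennreal t < T (X x s \<omega>) \<omega>' \<and> X (X x s \<omega>) t \<omega>' \<in> N}"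
begin

lemma space_F: "0 \<le> s \<Longrightarrow> space (F s) = space P"
  using subalg by (auto simp: subalgebra_def)

lemma measurable_F_P: "0 \<le> s \<Longrightarrow> f \<in> measurable (F s) N \<Longrightarrow> f \<in> measurable P N"
  using measurable_from_subalg subalg by blast

lemma measurable_F_mono: "0 \<le> s \<Longrightarrow> s \<le> t \<Longrightarrow> f \<in> measurable (F s) N \<Longrightarrow> f \<in> measurable (F t) N"
  using F_mono[of s t] space_F[of s] space_F[of t] by (auto simp: measurable_def)

text \<open>This is \<open>f\<close> along the path, extended by 0 to a cemetery state. The value 0
  at negative times makes it a function on the whole time line.\<close>

definition killed :: "('a \<Rightarrow> ennreal) \<Rightarrow> 'a \<Rightarrow> real \<Rightarrow> 'w \<Rightarrow> ennreal" where
  "killed f x u \<omega> = (if 0 \<le> u \<and> ennreal u < T x \<omega> then f (X x u \<omega>) else 0)"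

text \<open>Averaging over paths, and not against a kernel, makes this additive and continuous along
  increasing sequences by ordinary integration theory on \<open>P\<close>.\<close>

definition semigroup :: "('a \<Rightarrow> ennreal) \<Rightarrow> real \<Rightarrow> 'a \<Rightarrow> ennreal" where
  "semigroup f r y = (\<integral>\<^sup>+\<omega>. killed f y r \<omega> \<partial>P)"

section \<open>Measurability of the killed process\<close>

lemma pred_alive_in:
  assumes "0 \<le> u" "N \<in> sets borel"
  shows "Measurable.pred (F u) (\<lambda>\<omega>. ennreal u < T x \<omega> \<and> X x u \<omega> \<in> N)"
  using adapted[OF assms] space_F assms by (auto simp: pred_def)

lemma pred_alive: "0 \<le> u \<Longrightarrow> Measurable.pred (F u) (\<lambda>\<omega>. ennreal u < T x \<omega>)"
  using pred_alive_in[of u UNIV] by simp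

lemma measurable_killed:
  assumes "0 \<le> u" and [measurable]: "f \<in> borel_measurable borel"
  shows "killed f x u \<in> borel_measurable (F u)"
proof (rule borel_measurableI_greater)
  fix c
  have "Measurable.pred (F u) (\<lambda>\<omega>. ennreal u < T x \<omega> \<and> X x u \<omega> \<in> {z. c < f z})"
    by (rule pred_alive_in) (use assms in auto)
  then show "{\<omega> \<in> space (F u). c < killed f x u \<omega>} \<in> sets (F u)"
    unfolding pred_def
    by (rule back_subst[of "\<lambda>A. A \<in> sets _"]) (use assms(1) in \<open>auto simp: killed_def split: if_split_asm\<close>)
qed

lemma measurable_killed_P:
  assumes "f \<in> borel_measurable borel"
  shows "killed f x u \<in> borel_measurable P"
proof (cases "0 \<le> u")
  case True
  then show ?thesis using measurable_killed[OF True assms] measurable_F_P by blast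
next
  case False
  then have "killed f x u = (\<lambda>_. 0)" by (auto simp: killed_def)
  then show ?thesis by simp
qed

text \<open>For open sets the event at \<open>u\<close> is read off from grid times to the right of
  \<open>u\<close>. Capping these at \<open>t\<close> keeps every event in \<open>F t\<close>, and
  at \<open>u = t\<close> the capped sequence is constant. Borel sets follow by induction over the
  generated sigma-algebra.\<close>

lemma pred_progressive:
  assumes t: "0 \<le> t" and N: "N \<in> sets borel"
  shows "Measurable.pred (borel \<Otimes>\<^sub>M F t)
    (\<lambda>(u, \<omega>). 0 \<le> u \<and> u \<le> t \<and> ennreal u < T x \<omega> \<and> X x u \<omega> \<in> N)" (is "?Q N")
proof -
  have open_case: "?Q U" if "open U" for U :: "'a set"
  proof -
    obtain V :: "nat \<Rightarrow> 'a set"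
      where V: "\<And>m. open (V m)" "\<And>m. closure (V m) \<subseteq> U" "(\<Union>m. V m) = U"
      by (rule regular_open_exhaustion[OF regular[OF \<open>open U\<close>]]) (assumption, rule that)
    have meas[measurable]: "Measurable.pred (borel \<Otimes>\<^sub>M F t)
       (\<lambda>(u::real, \<omega>). ennreal (min t (grid n u)) < T x \<omega> \<and> X x (min t (grid n u)) \<omega> \<in> V m)" for n m
    proof (rule measurable_grid_compose[where M="F t" and f="\<lambda>r \<omega>. ennreal (min t r) < T x \<omega> \<and> X x (min t r) \<omega> \<in> V m"])
      fix r :: real assume "0 < r"
      then show "Measurable.pred (F t) (\<lambda>\<omega>. ennreal (min t r) < T x \<omega> \<and> X x (min t r) \<omega> \<in> V m)"
        using t V(1) by (intro measurable_F_mono[OF _ _ pred_alive_in]) auto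
    qed
    \<comment> \<open>A path alive at \<open>u\<close> lies in the open set \<open>U\<close> exactly
      if, for some \<open>m\<close>, it is alive and in \<open>V m\<close> at all sufficiently fine
      capped grid times. This uses countably many events only.\<close>
    have "Measurable.pred (borel \<Otimes>\<^sub>M F t) (\<lambda>z::real \<times> 'w. (0 \<le> fst z \<and> fst z \<le> t) \<and>
        (\<exists>m. \<exists>k. \<forall>n\<ge>k. (\<lambda>(u::real, \<omega>). ennreal (min t (grid n u)) < T x \<omega> \<and> X x (min t (grid n u)) \<omega> \<in> V m) z))"
      by measurable
    then show ?thesis
    proof (rule measurable_cong[THEN iffD1, rotated])
      fix z :: "real \<times> 'w" assume "z \<in> space (borel \<Otimes>\<^sub>M F t)"
      then obtain u \<omega> where z: "z = (u, \<omega>)" and \<omega>: "\<omega> \<in> space P"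
        using space_F[OF t] by (auto simp: space_pair_measure)
      let ?e = "\<lambda>n. min t (grid n u)"
      show "((0 \<le> fst z \<and> fst z \<le> t) \<and>
          (\<exists>m k. \<forall>n\<ge>k. (\<lambda>(u::real, \<omega>). ennreal (min t (grid n u)) < T x \<omega> \<and> X x (min t (grid n u)) \<omega> \<in> V m) z)) =
        (\<lambda>(u, \<omega>). 0 \<le> u \<and> u \<le> t \<and> ennreal u < T x \<omega> \<and> X x u \<omega> \<in> U) z"
      proof (cases "0 \<le> u \<and> u \<le> t")
        case True
        have e: "u \<le> ?e n" for n using True grid_bounds(1)[of u n] by auto
        have "?e \<longlonglongrightarrow> min t u" using True by (intro tendsto_intros grid_tendsto) auto
        then have elim: "?e \<longlonglongrightarrow> u" using True by (simp add: min_def split: if_splits)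
        note * = path_right_limit_open[OF continuous_paths[OF \<omega>] e elim]
          path_right_limit_closure[OF continuous_paths[OF \<omega>] e elim]
        have "(\<exists>m. \<forall>\<^sub>F n in sequentially. ennreal (?e n) < T x \<omega> \<and> X x (?e n) \<omega> \<in> V m) \<longleftrightarrow>
           ennreal u < T x \<omega> \<and> X x u \<omega> \<in> U" (is "?l \<longleftrightarrow> ?r")
        proof
          assume ?l
          then obtain m where m: "\<forall>\<^sub>F n in sequentially. ennreal (?e n) < T x \<omega> \<and> X x (?e n) \<omega> \<in> V m" ..
          show ?r
          proof (rule ccontr)
            assume "\<not> ?r"
            with *(2)[OF _ _ V(2)[of m], of x] True
            have "\<forall>\<^sub>F n in sequentially. \<not> (ennreal (?e n) < T x \<omega> \<and> X x (?e n) \<omega> \<in> V m)" by blast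
            with m have "\<forall>\<^sub>F n::nat in sequentially. False" by eventually_elim auto
            then show False by simp
          qed
        next
          assume ?r
          moreover then obtain m where "X x u \<omega> \<in> V m" using V(3) by blast
          ultimately show ?l using *(1)[of x "V m"] True V(1) by blast
        qed
        then show ?thesis using True by (simp add: z eventually_sequentially)
      qed (auto simp: z)
    qed
  qed
  have "N \<in> sigma_sets UNIV {S. open S}" using N by (simp add: borel_def)
  then show ?thesis
  proof (induction N rule: sigma_sets.induct)
    case (Basic a)
    then show ?case using open_case by simp
  next
    case Empty
    show ?case by simp
  next
    case (Compl a)
    \<comment> \<open>The complement is taken within the event of being alive at a time
      \<open>u\<close> in \<open>{0..t}\<close>, which is the case of the open set
      \<open>UNIV\<close>.\<close>
    note [measurable] = Compl(2) open_case[OF open_UNIV]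
    have "Measurable.pred (borel \<Otimes>\<^sub>M F t) (\<lambda>z. (\<lambda>(u, \<omega>). 0 \<le> u \<and> u \<le> t \<and> ennreal u < T x \<omega> \<and> X x u \<omega> \<in> UNIV) z
       \<and> \<not> (\<lambda>(u, \<omega>). 0 \<le> u \<and> u \<le> t \<and> ennreal u < T x \<omega> \<and> X x u \<omega> \<in> a) z)"
      by measurable
    then show ?case by (rule measurable_cong[THEN iffD1, rotated]) auto
  next
    case (Union a)
    note [measurable] = Union(2)
    have "Measurable.pred (borel \<Otimes>\<^sub>M F t) (\<lambda>z. \<exists>i::nat. (\<lambda>(u, \<omega>). 0 \<le> u \<and> u \<le> t \<and> ennreal u < T x \<omega> \<and> X x u \<omega> \<in> a i) z)"
      by measurable
    then show ?case by (rule measurable_cong[THEN iffD1, rotated]) auto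
  qed
qed

lemma measurable_killed_progressive:
  assumes t: "0 \<le> t" and [measurable]: "f \<in> borel_measurable borel"
  shows "(\<lambda>(u, \<omega>). killed f x u \<omega> * indicator {..t} u) \<in> borel_measurable (borel \<Otimes>\<^sub>M F t)"
proof (rule borel_measurableI_greater)
  fix c
  have "Measurable.pred (borel \<Otimes>\<^sub>M F t)
    (\<lambda>(u, \<omega>). 0 \<le> u \<and> u \<le> t \<and> ennreal u < T x \<omega> \<and> X x u \<omega> \<in> {z. c < f z})"
    by (rule pred_progressive[OF t]) auto
  then show "{z \<in> space (borel \<Otimes>\<^sub>M F t). c < (case z of (u, \<omega>) \<Rightarrow> killed f x u \<omega> * indicator {..t} u)}
      \<in> sets (borel \<Otimes>\<^sub>M F t)"
    unfolding pred_def
    by (rule back_subst[of "\<lambda>A. A \<in> sets _"]) (auto simp: killed_def split: split_indicator_asm if_split_asm)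
qed

lemma measurable_pair_F_P:
  assumes "0 \<le> t" "f \<in> measurable (borel \<Otimes>\<^sub>M F t) N"
  shows "f \<in> measurable (borel \<Otimes>\<^sub>M P) N"
proof -
  have "(\<lambda>z. z) \<in> measurable P (F t)" using assms(1) by (rule measurable_F_P) simp
  then have "(\<lambda>z. (fst z, snd z)) \<in> measurable (borel \<Otimes>\<^sub>M P) (borel \<Otimes>\<^sub>M F t)"
    by (intro measurable_Pair measurable_fst measurable_compose[OF measurable_snd])
  from measurable_compose[OF this assms(2)] show ?thesis by simp
qed

lemma measurable_killed_pair:
  assumes [measurable]: "f \<in> borel_measurable borel"
  shows "(\<lambda>(u, \<omega>). killed f x u \<omega>) \<in> borel_measurable (borel \<Otimes>\<^sub>M P)"
proof -
  have "(\<lambda>z. SUP n. (\<lambda>(u, \<omega>). killed f x u \<omega> * indicator {..real n} u) z) \<in> borel_measurable (borel \<Otimes>\<^sub>M P)"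
    by (intro borel_measurable_SUP measurable_pair_F_P[OF _ measurable_killed_progressive]) auto
  also have "(\<lambda>z. SUP n. (\<lambda>(u, \<omega>). killed f x u \<omega> * indicator {..real n} u) z) = (\<lambda>(u, \<omega>). killed f x u \<omega>)"
  proof (intro ext, clarify)
    fix u :: real and \<omega>
    obtain n where "u \<le> real n" using real_arch_simple by blast
    then have "killed f x u \<omega> \<le> (SUP n. killed f x u \<omega> * indicator {..real n} u)"
      by (intro SUP_upper2[of n]) auto
    moreover have "(SUP n. killed f x u \<omega> * indicator {..real n} u) \<le> killed f x u \<omega>"
      by (intro SUP_least) (auto simp: indicator_def)
    ultimately show "(SUP n. killed f x u \<omega> * indicator {..real n} u) = killed f x u \<omega>"
      by simp
  qed
  finally show ?thesis .
qed

section \<open>Linearity and monotone limits of the semigroup\<close>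

lemma killed_add: "killed (\<lambda>z. f z + g z) y u \<omega> = killed f y u \<omega> + killed g y u \<omega>"
  by (simp add: killed_def)

lemma killed_cmult: "killed (\<lambda>z. c * f z) y u \<omega> = c * killed f y u \<omega>"
  by (simp add: killed_def)

lemma killed_SUP: "killed (SUP i. U i) y u \<omega> = (SUP i. killed (U i) y u \<omega>)"
  by (auto simp: killed_def image_comp)

lemma killed_indicator:
  "0 \<le> u \<Longrightarrow> \<omega> \<in> space P \<Longrightarrow>
    killed (indicator N) y u \<omega> = indicator {\<omega>\<in>space P. ennreal u < T y \<omega> \<and> X y u \<omega> \<in> N} \<omega>"
  by (auto simp: killed_def indicator_def)

lemma semigroup_add:
  assumes [measurable]: "f \<in> borel_measurable borel" "g \<in> borel_measurable borel"
  shows "semigroup (\<lambda>z. f z + g z) r y = semigroup f r y + semigroup g r y"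
  unfolding semigroup_def killed_add by (intro nn_integral_add measurable_killed_P assms)

lemma semigroup_cmult:
  assumes "f \<in> borel_measurable borel"
  shows "semigroup (\<lambda>z. c * f z) r y = c * semigroup f r y"
  unfolding semigroup_def killed_cmult by (intro nn_integral_cmult measurable_killed_P assms)

lemma semigroup_SUP:
  assumes "\<And>i. U i \<in> borel_measurable borel" "incseq U"
  shows "semigroup (SUP i. U i) r y = (SUP i::nat. semigroup (U i) r y)"
  unfolding semigroup_def killed_SUP
  by (intro nn_integral_monotone_convergence_SUP measurable_killed_P assms)
     (use assms(2) in \<open>auto simp: incseq_def le_fun_def killed_def\<close>)

lemma semigroup_indicator:
  assumes "0 \<le> r" and N: "N \<in> sets borel"
  shows "semigroup (indicator N) r y = emeasure P {\<omega>\<in>space P. ennreal r < T y \<omega> \<and> X y r \<omega> \<in> N}"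
proof -
  have "{\<omega>\<in>space P. ennreal r < T y \<omega> \<and> X y r \<omega> \<in> N} \<in> sets P"
    using adapted[OF assms] subalg[OF assms(1)] by (auto simp: subalgebra_def)
  then show ?thesis
    unfolding semigroup_def using assms(1) by (simp add: killed_indicator cong: nn_integral_cong)
qed

lemma semigroup_indicator_le_1: "semigroup (indicator N) r y \<le> 1"
proof -
  have "semigroup (indicator N) r y \<le> (\<integral>\<^sup>+\<omega>. 1 \<partial>P)"
    unfolding semigroup_def by (intro nn_integral_mono) (auto simp: killed_def indicator_def)
  then show ?thesis by (simp add: emeasure_space_1)
qed

lemma semigroup_negative_time: "r < 0 \<Longrightarrow> semigroup f r y = 0"
  by (simp add: semigroup_def killed_def)

section \<open>The semigroup evaluated along a path\<close>

lemma nn_cond_exp_killed_indicator: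
  assumes "0 \<le> s" "0 < r" "N \<in> sets borel"
  shows "AE \<omega> in P. nn_cond_exp P (F s) (killed (indicator N) x (s + r)) \<omega> =
    indicator {\<omega>. ennreal s < T x \<omega>} \<omega> * semigroup (indicator N) r (X x s \<omega>)"
proof -
  let ?A = "{\<omega>\<in>space P. ennreal (s + r) < T x \<omega> \<and> X x (s + r) \<omega> \<in> N}"
  have A: "?A \<in> sets P"
    using adapted[of "s + r" N x] subalg[of "s + r"] assms by (auto simp: subalgebra_def)
  interpret finite_measure_subalgebra P "F s"
    by unfold_locales (rule subalg[OF assms(1)])
  have "AE \<omega> in P. nn_cond_exp P (F s) (killed (indicator N) x (s + r)) \<omega> = nn_cond_exp P (F s) (indicator ?A) \<omega>"
  proof (rule nn_cond_exp_cong)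
    show "indicator ?A \<in> borel_measurable P" using A by simp
  qed (use assms in \<open>auto simp: killed_indicator intro!: AE_I2 measurable_killed_P\<close>)
  with markov[OF assms] show ?thesis
    by eventually_elim (simp add: semigroup_indicator assms less_imp_le)
qed

text \<open>The semigroup is not known to be measurable in its starting point. Its composition with
  the path is, because the Markov property makes it almost everywhere equal to a conditional
  expectation.\<close>

lemma measurable_semigroup_indicator_at:
  assumes "0 \<le> s" "0 < r" "N \<in> sets borel"
  shows "(\<lambda>\<omega>. indicator {\<omega>. ennreal s < T x \<omega>} \<omega> * semigroup (indicator N) r (X x s \<omega>)) \<in> borel_measurable P"
  using nn_cond_exp_killed_indicator[OF assms]
  by (rule borel_measurable_ennreal_AE[rotated]) (rule borel_measurable_nn_cond_exp2)

text \<open>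
  Path continuity expresses the semigroup at time \<open>r\<close> through times on a grid to the right of \<open>r\<close>.
  This yields joint measurability in \<open>(r, \<omega>)\<close>, which Fubini's theorem requires below.
\<close>

lemma semigroup_indicator_open:
  fixes V :: "nat \<Rightarrow> 'a set"
  assumes r: "0 \<le> r" and V: "\<And>m. open (V m)" "\<And>m. closure (V m) \<subseteq> U" "incseq V" "(\<Union>m. V m) = U"
  shows "semigroup (indicator U) r y =
    (SUP m. liminf (\<lambda>n. semigroup (indicator (V m)) (grid n r) y))"
proof (rule antisym)
  have [measurable]: "V m \<in> sets borel" for m using V(1) by simp
  have gr: "r \<le> grid n r" "0 \<le> grid n r" for n
    using grid_bounds(1)[OF r, of n] grid_pos[of n r] by auto
  have "semigroup (indicator U) r y = semigroup (SUP m. indicator (V m)) r y"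
  proof -
    have "indicator U z = (SUP m. indicator (V m) z :: ennreal)" for z
    proof (rule antisym)
      show "indicator U z \<le> (SUP m. indicator (V m) z :: ennreal)"
      proof (cases "z \<in> U")
        case True
        then obtain m where "z \<in> V m" using V(4) by blast
        then show ?thesis by (intro SUP_upper2[of m]) (auto simp: indicator_def)
      qed simp
      show "(SUP m. indicator (V m) z :: ennreal) \<le> indicator U z"
        using V(4) by (intro SUP_least) (auto simp: indicator_def)
    qed
    then have "(indicator U :: _ \<Rightarrow> ennreal) = (SUP m. indicator (V m))"
      by (auto simp: fun_eq_iff image_comp)
    then show ?thesis by simp
  qed
  also have "\<dots> = (SUP m. semigroup (indicator (V m)) r y)"
    using V(3) by (intro semigroup_SUP) (auto simp: incseq_def le_fun_def indicator_def)
  also have "\<dots> \<le> (SUP m. liminf (\<lambda>n. semigroup (indicator (V m)) (grid n r) y))"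
  proof (intro SUP_mono' )
    fix m
    \<comment> \<open>A path alive in the open set \<open>V m\<close> at time \<open>r\<close> is
      still there shortly afterwards, so Fatou's lemma gives the lower bound.\<close>
    have "semigroup (indicator (V m)) r y \<le> (\<integral>\<^sup>+\<omega>. liminf (\<lambda>n. killed (indicator (V m)) y (grid n r) \<omega>) \<partial>P)"
      unfolding semigroup_def
    proof (intro nn_integral_mono)
      fix \<omega> assume \<omega>: "\<omega> \<in> space P"
      show "killed (indicator (V m)) y r \<omega> \<le> liminf (\<lambda>n. killed (indicator (V m)) y (grid n r) \<omega>)"
      proof (cases "ennreal r < T y \<omega> \<and> X y r \<omega> \<in> V m")
        case True
        have "\<forall>\<^sub>F n in sequentially. killed (indicator (V m)) y r \<omega> \<le> killed (indicator (V m)) y (grid n r) \<omega>"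
          using path_right_limit_open[OF continuous_paths[OF \<omega>] gr(1) grid_tendsto[OF r] r, of y "V m"] True V(1)
          by (auto simp: killed_def gr indicator_def elim!: eventually_mono)
        then show ?thesis by (rule Liminf_bounded)
      next
        case False
        then have "killed (indicator (V m)) y r \<omega> = 0" by (auto simp: killed_def)
        then show ?thesis by simp
      qed
    qed
    also have "\<dots> \<le> liminf (\<lambda>n. semigroup (indicator (V m)) (grid n r) y)"
      unfolding semigroup_def by (intro nn_integral_liminf measurable_killed_P) auto
    finally show "semigroup (indicator (V m)) r y \<le> liminf (\<lambda>n. semigroup (indicator (V m)) (grid n r) y)" .
  qed
  finally show "semigroup (indicator U) r y \<le> (SUP m. liminf (\<lambda>n. semigroup (indicator (V m)) (grid n r) y))" .
  show "(SUP m. liminf (\<lambda>n. semigroup (indicator (V m)) (grid n r) y)) \<le> semigroup (indicator U) r y"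
  proof (rule SUP_least)
    fix m
    have "liminf (\<lambda>n. semigroup (indicator (V m)) (grid n r) y) \<le> limsup (\<lambda>n. semigroup (indicator (V m)) (grid n r) y)"
      by (rule Liminf_le_Limsup) simp
    \<comment> \<open>This is the reverse Fatou lemma with the dominating function 1. Since
      \<open>closure (V m) \<subseteq> U\<close>, a path that is dead or outside \<open>U\<close> at
      \<open>r\<close> avoids \<open>V m\<close> shortly afterwards.\<close>
    also have "\<dots> \<le> (\<integral>\<^sup>+\<omega>. limsup (\<lambda>n. killed (indicator (V m)) y (grid n r) \<omega>) \<partial>P)"
      unfolding semigroup_def
      by (intro nn_integral_limsup[where w="\<lambda>_. 1"] measurable_killed_P)
         (auto simp: emeasure_space_1 killed_def indicator_def)
    also have "\<dots> \<le> semigroup (indicator U) r y"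
      unfolding semigroup_def
    proof (intro nn_integral_mono)
      fix \<omega> assume \<omega>: "\<omega> \<in> space P"
      show "limsup (\<lambda>n. killed (indicator (V m)) y (grid n r) \<omega>) \<le> killed (indicator U) y r \<omega>"
      proof (cases "ennreal r < T y \<omega> \<and> X y r \<omega> \<in> U")
        case False
        have "\<forall>\<^sub>F n in sequentially. killed (indicator (V m)) y (grid n r) \<omega> \<le> 0"
          using path_right_limit_closure[OF continuous_paths[OF \<omega>] gr(1) grid_tendsto[OF r] r False V(2)]
          by (auto simp: killed_def gr indicator_def elim!: eventually_mono)
        then have "limsup (\<lambda>n. killed (indicator (V m)) y (grid n r) \<omega>) \<le> 0" by (rule Limsup_bounded)
        then show ?thesis by simp
      next
        case True
        then have "killed (indicator U) y r \<omega> = 1" using r by (auto simp: killed_def)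
        moreover have "limsup (\<lambda>n. killed (indicator (V m)) y (grid n r) \<omega>) \<le> 1"
          by (intro Limsup_bounded always_eventually) (auto simp: killed_def indicator_def)
        ultimately show ?thesis by simp
      qed
    qed
    finally show "liminf (\<lambda>n. semigroup (indicator (V m)) (grid n r) y) \<le> semigroup (indicator U) r y" .
  qed
qed

text \<open>For open sets the grid formula reduces the claim to fixed positive times. The remaining
  Borel sets follow by Dynkin's argument, as open sets are stable under intersection and the
  semigroup respects complements and disjoint unions.\<close>

lemma measurable_semigroup_indicator_pair:
  assumes s: "0 \<le> s" and N: "N \<in> sets borel"
  shows "(\<lambda>(r, \<omega>). indicator {\<omega>. ennreal s < T x \<omega>} \<omega> * semigroup (indicator N) r (X x s \<omega>))
    \<in> borel_measurable (borel \<Otimes>\<^sub>M P)" (is "?H N \<in> _")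
proof -
  have open_case: "?H U \<in> borel_measurable (borel \<Otimes>\<^sub>M P)" if "open U" for U :: "'a set"
  proof -
    obtain V :: "nat \<Rightarrow> 'a set"
      where V: "\<And>m. open (V m)" "\<And>m. closure (V m) \<subseteq> U" "incseq V" "(\<Union>m. V m) = U"
      by (rule regular_open_exhaustion[OF regular[OF \<open>open U\<close>]]) (assumption, rule that)
    have [measurable]: "(\<lambda>(r::real, \<omega>). indicator {\<omega>. ennreal s < T x \<omega>} \<omega> *
        semigroup (indicator (V m)) (grid n r) (X x s \<omega>)) \<in> borel_measurable (borel \<Otimes>\<^sub>M P)" for m n
      by (rule measurable_grid_compose[where M=P and f="\<lambda>r \<omega>. indicator {\<omega>. ennreal s < T x \<omega>} \<omega> *
        semigroup (indicator (V m)) r (X x s \<omega>)"])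
         (use s V(1) in \<open>auto intro!: measurable_semigroup_indicator_at\<close>)
    \<comment> \<open>The grid formula holds for \<open>r \<ge> 0\<close>; the factor
      \<open>indicator {0..}\<close> supplies the value 0 of the semigroup at negative
      times.\<close>
    have "(\<lambda>z::real \<times> 'w. indicator {0..} (fst z) * (SUP m. liminf (\<lambda>n. (\<lambda>(r, \<omega>). indicator {\<omega>. ennreal s < T x \<omega>} \<omega> *
        semigroup (indicator (V m)) (grid n r) (X x s \<omega>)) z))) \<in> borel_measurable (borel \<Otimes>\<^sub>M P)"
      by measurable
    also have "(\<lambda>z::real \<times> 'w. indicator {0..} (fst z) * (SUP m. liminf (\<lambda>n. (\<lambda>(r, \<omega>). indicator {\<omega>. ennreal s < T x \<omega>} \<omega> *
        semigroup (indicator (V m)) (grid n r) (X x s \<omega>)) z))) = ?H U"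
    proof (intro ext, clarify)
      fix r :: real and \<omega>
      show "indicator {0..} (fst (r, \<omega>)) * (SUP m. liminf (\<lambda>n. indicator {\<omega>. ennreal s < T x \<omega>} \<omega> *
          semigroup (indicator (V m)) (grid n r) (X x s \<omega>))) =
        indicator {\<omega>. ennreal s < T x \<omega>} \<omega> * semigroup (indicator U) r (X x s \<omega>)"
      proof (cases "0 \<le> r \<and> ennreal s < T x \<omega>")
        case True
        then show ?thesis by (simp add: semigroup_indicator_open[OF _ V])
      next
        case False
        then show ?thesis by (auto simp: semigroup_negative_time not_le Liminf_const)
      qed
    qed
    finally show ?thesis .
  qed
  note [measurable] = open_case[OF open_UNIV]
  \<comment> \<open>The subtracted term is at most 1, hence finite, so it cancels in
    \<open>ennreal\<close>.\<close>
  have *: "semigroup (indicator (UNIV - a)) r y = semigroup (indicator UNIV) r y - semigroup (indicator a) r y"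
    if [measurable]: "a \<in> sets borel" for a :: "'a set" and r y
  proof -
    have "semigroup (indicator UNIV) r y = semigroup (\<lambda>z. indicator (UNIV - a) z + indicator a z) r y"
      by (intro arg_cong[where f="\<lambda>f. semigroup f r y"]) (auto simp: indicator_def)
    also have "\<dots> = semigroup (indicator (UNIV - a)) r y + semigroup (indicator a) r y"
      by (intro semigroup_add) auto
    finally show ?thesis
      using neq_top_trans[OF ennreal_one_neq_top semigroup_indicator_le_1[of a r y]] by simp
  qed
  have N': "N \<in> sigma_sets UNIV {S. open S}" using N by (simp add: borel_def)
  show ?thesis
  proof (rule sigma_sets_induct_disjoint[OF _ _ N'])
    show "Int_stable {S :: 'a set. open S}" by (auto simp: Int_stable_def)
    show "{S :: 'a set. open S} \<subseteq> Pow UNIV" by simp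
    show "?H a \<in> borel_measurable (borel \<Otimes>\<^sub>M P)" if "a \<in> {S. open S}" for a using open_case that by simp
    show "?H {} \<in> borel_measurable (borel \<Otimes>\<^sub>M P)" by (rule open_case) simp
  next
    fix a :: "'a set" assume a: "a \<in> sigma_sets UNIV {S. open S}"
      and [measurable]: "?H a \<in> borel_measurable (borel \<Otimes>\<^sub>M P)"
    have a': "a \<in> sets borel" using a by (simp add: borel_def)
    have "(\<lambda>z. ?H UNIV z - ?H a z) \<in> borel_measurable (borel \<Otimes>\<^sub>M P)" by measurable
    also have "(\<lambda>z. ?H UNIV z - ?H a z) = ?H (UNIV - a)"
    proof (intro ext, clarify)
      fix r :: real and \<omega>
      show "indicator {\<omega>. ennreal s < T x \<omega>} \<omega> * semigroup (indicator UNIV) r (X x s \<omega>) -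
          indicator {\<omega>. ennreal s < T x \<omega>} \<omega> * semigroup (indicator a) r (X x s \<omega>) =
        indicator {\<omega>. ennreal s < T x \<omega>} \<omega> * semigroup (indicator (UNIV - a)) r (X x s \<omega>)"
        by (cases "ennreal s < T x \<omega>") (simp_all add: *[OF a'] del: indicator_UNIV)
    qed
    finally show "?H (UNIV - a) \<in> borel_measurable (borel \<Otimes>\<^sub>M P)" .
  next
    fix a :: "nat \<Rightarrow> 'a set" assume disj: "disjoint_family a" and a: "range a \<subseteq> sigma_sets UNIV {S. open S}"
      and [measurable]: "\<And>i. ?H (a i) \<in> borel_measurable (borel \<Otimes>\<^sub>M P)"
    have a': "a i \<in> sets borel" for i using a by (auto simp: borel_def)
    have "(\<lambda>z. \<Sum>i. ?H (a i) z) \<in> borel_measurable (borel \<Otimes>\<^sub>M P)" by measurable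
    also have "(\<lambda>z. \<Sum>i. ?H (a i) z) = ?H (\<Union>i. a i)"
    proof (intro ext, clarify)
      fix r :: real and \<omega>
      have "semigroup (indicator (\<Union>i. a i)) r y = (\<Sum>i. semigroup (indicator (a i)) r y)" for y
      proof -
        have "(\<Sum>i. semigroup (indicator (a i)) r y) = (\<integral>\<^sup>+\<omega>. (\<Sum>i. killed (indicator (a i)) y r \<omega>) \<partial>P)"
          unfolding semigroup_def by (intro nn_integral_suminf[symmetric] measurable_killed_P) (use a' in auto)
        also have "\<dots> = semigroup (indicator (\<Union>i. a i)) r y"
          unfolding semigroup_def
          by (intro nn_integral_cong) (auto simp: killed_def suminf_indicator[OF disj])
        finally show ?thesis by simp
      qed
      then show "(\<Sum>i. indicator {\<omega>. ennreal s < T x \<omega>} \<omega> * semigroup (indicator (a i)) r (X x s \<omega>)) =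
         indicator {\<omega>. ennreal s < T x \<omega>} \<omega> * semigroup (indicator (\<Union>i. a i)) r (X x s \<omega>)"
        by (simp add: ennreal_suminf_cmult)
    qed
    finally show "?H (\<Union>i. a i) \<in> borel_measurable (borel \<Otimes>\<^sub>M P)" .
  qed
qed

lemma measurable_semigroup_pair:
  assumes f: "f \<in> borel_measurable borel" and s: "0 \<le> s"
  shows "(\<lambda>(r, \<omega>). indicator {\<omega>. ennreal s < T x \<omega>} \<omega> * semigroup f r (X x s \<omega>))
    \<in> borel_measurable (borel \<Otimes>\<^sub>M P)" (is "?H f \<in> _")
  using f
proof (induction f rule: borel_measurable_induct)
  case (cong f g)
  then have "f = g" by auto
  then show ?case using cong by simp
next
  case (set A)
  then show ?case by (rule measurable_semigroup_indicator_pair[OF s])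
next
  case (mult u c)
  note [measurable] = mult.IH
  have "(\<lambda>z. c * ?H u z) \<in> borel_measurable (borel \<Otimes>\<^sub>M P)" by measurable
  then show ?case by (simp add: semigroup_cmult[OF mult.hyps(2)] split_def mult.left_commute)
next
  case (add u v)
  note [measurable] = add.IH
  have "(\<lambda>z. ?H v z + ?H u z) \<in> borel_measurable (borel \<Otimes>\<^sub>M P)" by measurable
  then show ?case by (simp add: semigroup_add add.hyps(1,3) split_def distrib_left)
next
  case (seq U)
  note [measurable] = seq.IH
  have eq: "?H (SUP i. U i) = (\<lambda>z. SUP i. ?H (U i) z)"
    unfolding semigroup_SUP[OF seq.hyps(1,3)] by (simp add: split_def SUP_mult_left_ennreal)
  show ?case unfolding eq by measurable
qed

section \<open>The Markov property tested against weights\<close>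

lemma measurable_semigroup_at:
  assumes "f \<in> borel_measurable borel" "0 \<le> s"
  shows "(\<lambda>\<omega>. indicator {\<omega>. ennreal s < T x \<omega>} \<omega> * semigroup f r (X x s \<omega>)) \<in> borel_measurable P"
  using measurable_compose[OF measurable_Pair1' measurable_semigroup_pair[OF assms, of x], of r] by simp

text \<open>Testing against weights turns the almost sure identity for conditional expectations into
  one that can be integrated in \<open>r\<close>, without null sets that depend on \<open>r\<close>.
  The extension from indicators is by monotone approximation.\<close>

lemma markov_killed:
  assumes f: "f \<in> borel_measurable borel" and s: "0 \<le> s" and r: "0 < r"
    and Z: "Z \<in> borel_measurable (F s)"
  shows "(\<integral>\<^sup>+\<omega>. Z \<omega> * killed f x (s + r) \<omega> \<partial>P) =
    (\<integral>\<^sup>+\<omega>. Z \<omega> * (indicator {\<omega>. ennreal s < T x \<omega>} \<omega> * semigroup f r (X x s \<omega>)) \<partial>P)"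
  using f
proof (induction f rule: borel_measurable_induct)
  note [measurable] = measurable_F_P[OF s Z]
  {
    case (cong f g)
    then have "f = g" by auto
    then show ?case using cong by simp
  next
    case (set A)
    interpret finite_measure_subalgebra P "F s"
      by unfold_locales (rule subalg[OF s])
    have "(\<integral>\<^sup>+\<omega>. Z \<omega> * killed (indicator A) x (s + r) \<omega> \<partial>P) =
        (\<integral>\<^sup>+\<omega>. Z \<omega> * nn_cond_exp P (F s) (killed (indicator A) x (s + r)) \<omega> \<partial>P)"
      using set by (intro nn_cond_exp_intg[symmetric] Z measurable_killed_P) auto
    also have "\<dots> = (\<integral>\<^sup>+\<omega>. Z \<omega> * (indicator {\<omega>. ennreal s < T x \<omega>} \<omega> * semigroup (indicator A) r (X x s \<omega>)) \<partial>P)"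
      using nn_cond_exp_killed_indicator[OF s r set, of x]
      by (intro nn_integral_cong_AE) auto
    finally show ?case .
  next
    case (mult u c)
    note [measurable] = mult.hyps(2) measurable_semigroup_at[OF mult.hyps(2) s] measurable_killed_P[OF mult.hyps(2)]
    show ?case
      using mult.IH
      by (simp add: killed_cmult semigroup_cmult[OF mult.hyps(2)] mult.left_commute[of _ c] nn_integral_cmult)
  next
    case (add u v)
    note [measurable] = add.hyps(1,3) measurable_semigroup_at[OF add.hyps(1) s] measurable_killed_P[OF add.hyps(1)]
      measurable_semigroup_at[OF add.hyps(3) s] measurable_killed_P[OF add.hyps(3)]
    show ?case
      using add.IH
      by (simp add: killed_add semigroup_add[OF add.hyps(3,1)] distrib_left nn_integral_add)
  next
    case (seq U)
    note [measurable] = measurable_semigroup_at[OF seq.hyps(1) s] measurable_killed_P[OF seq.hyps(1)]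
    have mono: "U i z \<le> U j z" if "i \<le> j" for i j z
      using seq.hyps(3) that by (auto simp: incseq_def le_fun_def)
    have "(\<integral>\<^sup>+\<omega>. Z \<omega> * killed (SUP i. U i) x (s + r) \<omega> \<partial>P) =
        (\<integral>\<^sup>+\<omega>. (SUP i. Z \<omega> * killed (U i) x (s + r) \<omega>) \<partial>P)"
      unfolding killed_SUP SUP_mult_left_ennreal ..
    also have "\<dots> = (SUP i. \<integral>\<^sup>+\<omega>. Z \<omega> * killed (U i) x (s + r) \<omega> \<partial>P)"
    proof (rule nn_integral_monotone_convergence_SUP)
      show "incseq (\<lambda>i \<omega>. Z \<omega> * killed (U i) x (s + r) \<omega>)"
        by (auto simp: incseq_def le_fun_def killed_def intro!: mult_left_mono mono)
    qed measurable
    also have "\<dots> = (SUP i. \<integral>\<^sup>+\<omega>. Z \<omega> * (indicator {\<omega>. ennreal s < T x \<omega>} \<omega> * semigroup (U i) r (X x s \<omega>)) \<partial>P)"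
      using seq.IH by simp
    also have "\<dots> = (\<integral>\<^sup>+\<omega>. (SUP i. Z \<omega> * (indicator {\<omega>. ennreal s < T x \<omega>} \<omega> * semigroup (U i) r (X x s \<omega>))) \<partial>P)"
    proof (rule nn_integral_monotone_convergence_SUP[symmetric])
      show "incseq (\<lambda>i \<omega>. Z \<omega> * (indicator {\<omega>. ennreal s < T x \<omega>} \<omega> * semigroup (U i) r (X x s \<omega>)))"
        by (auto simp: incseq_def le_fun_def killed_def semigroup_def intro!: mult_left_mono nn_integral_mono mono)
    qed measurable
    also have "\<dots> = (\<integral>\<^sup>+\<omega>. Z \<omega> * (indicator {\<omega>. ennreal s < T x \<omega>} \<omega> * semigroup (SUP i. U i) r (X x s \<omega>)) \<partial>P)"
      unfolding semigroup_SUP[OF seq.hyps(1,3)] SUP_mult_left_ennreal ..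
    finally show ?case .
  }
qed

text \<open>Fubini's theorem and the shift \<open>u = s + r\<close> allow the Markov property to be
  applied at each fixed \<open>r\<close>. A second exchange brings back the time integral, now of
  the semigroup started at \<open>X x s \<omega>\<close>.\<close>

lemma khasminskii_first_moment:
  assumes f [measurable]: "f \<in> borel_measurable borel" and s: "0 \<le> s"
    and Z: "Z \<in> borel_measurable (F s)"
    and le: "\<And>y. (\<integral>\<^sup>+r\<in>{0..h}. semigroup f r y \<partial>lborel) \<le> \<alpha>"
  shows "(\<integral>\<^sup>+\<omega>. Z \<omega> * (\<integral>\<^sup>+u\<in>{s..s+h}. killed f x u \<omega> \<partial>lborel) \<partial>P) \<le>
    \<alpha> * (\<integral>\<^sup>+\<omega>. Z \<omega> * indicator {\<omega>. ennreal s < T x \<omega>} \<omega> \<partial>P)"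
proof -
  interpret L: pair_sigma_finite lborel P ..
  note [measurable] = measurable_F_P[OF s Z] measurable_killed_pair[OF f] measurable_semigroup_pair[OF f s]
    measurable_F_P[OF s pred_alive[OF s]]
  define q where "q r \<omega> = indicator {\<omega>. ennreal s < T x \<omega>} \<omega> * semigroup f r (X x s \<omega>)" for r \<omega>
  have q [measurable]: "(\<lambda>(r, \<omega>). q r \<omega>) \<in> borel_measurable (borel \<Otimes>\<^sub>M P)"
    unfolding q_def by (rule measurable_semigroup_pair[OF f s])
  have "(\<integral>\<^sup>+\<omega>. Z \<omega> * (\<integral>\<^sup>+u\<in>{s..s+h}. killed f x u \<omega> \<partial>lborel) \<partial>P) =
      (\<integral>\<^sup>+\<omega>. \<integral>\<^sup>+u. Z \<omega> * killed f x u \<omega> * indicator {s..s+h} u \<partial>lborel \<partial>P)"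
    by (intro nn_integral_cong) (simp add: nn_integral_cmult mult.assoc)
  also have "\<dots> = (\<integral>\<^sup>+u. \<integral>\<^sup>+\<omega>. Z \<omega> * killed f x u \<omega> * indicator {s..s+h} u \<partial>P \<partial>lborel)"
    by (rule L.Fubini') measurable
  also have "\<dots> = (\<integral>\<^sup>+r. \<integral>\<^sup>+\<omega>. Z \<omega> * killed f x (s + r) \<omega> * indicator {s..s+h} (s + r) \<partial>P \<partial>lborel)"
    by (subst nn_integral_real_affine[where c=1 and t=s]) simp_all
  also have "\<dots> = (\<integral>\<^sup>+r. \<integral>\<^sup>+\<omega>. Z \<omega> * q r \<omega> * indicator {0..h} r \<partial>P \<partial>lborel)"
  proof (rule nn_integral_cong_AE)
    show "AE r in lborel. (\<integral>\<^sup>+\<omega>. Z \<omega> * killed f x (s + r) \<omega> * indicator {s..s+h} (s + r) \<partial>P) =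
        (\<integral>\<^sup>+\<omega>. Z \<omega> * q r \<omega> * indicator {0..h} r \<partial>P)"
      \<comment> \<open>The Markov property is available for \<open>r > 0\<close>; the single time 0
        is a null set.\<close>
      using AE_lborel_singleton[of 0]
    proof eventually_elim
      case (elim r)
      show ?case
      proof (cases "r \<in> {0..h}")
        case True
        then show ?thesis
          using markov_killed[OF f s _ Z, of r x] elim by (simp add: q_def)
      qed auto
    qed
  qed
  also have "\<dots> = (\<integral>\<^sup>+\<omega>. \<integral>\<^sup>+r. Z \<omega> * q r \<omega> * indicator {0..h} r \<partial>lborel \<partial>P)"
    by (rule L.Fubini'[symmetric]) measurable
  also have "\<dots> = (\<integral>\<^sup>+\<omega>. Z \<omega> * (\<integral>\<^sup>+r\<in>{0..h}. q r \<omega> \<partial>lborel) \<partial>P)"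
    by (intro nn_integral_cong) (simp add: nn_integral_cmult mult.assoc)
  also have "\<dots> \<le> (\<integral>\<^sup>+\<omega>. \<alpha> * (Z \<omega> * indicator {\<omega>. ennreal s < T x \<omega>} \<omega>) \<partial>P)"
  proof (intro nn_integral_mono)
    \<comment> \<open>The bound \<open>le\<close> is uniform in the starting point, hence holds at
      the random point \<open>X x s \<omega>\<close>.\<close>
    fix \<omega>
    have "(\<integral>\<^sup>+r\<in>{0..h}. q r \<omega> \<partial>lborel) \<le> \<alpha> * indicator {\<omega>. ennreal s < T x \<omega>} \<omega>"
      using le[of "X x s \<omega>"] by (simp add: q_def indicator_def)
    then have "Z \<omega> * (\<integral>\<^sup>+r\<in>{0..h}. q r \<omega> \<partial>lborel) \<le> Z \<omega> * (\<alpha> * indicator {\<omega>. ennreal s < T x \<omega>} \<omega>)"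
      by (rule mult_left_mono) simp
    then show "Z \<omega> * (\<integral>\<^sup>+r\<in>{0..h}. q r \<omega> \<partial>lborel) \<le> \<alpha> * (Z \<omega> * indicator {\<omega>. ennreal s < T x \<omega>} \<omega>)"
      by (simp add: mult.left_commute)
  qed
  also have "\<dots> = \<alpha> * (\<integral>\<^sup>+\<omega>. Z \<omega> * indicator {\<omega>. ennreal s < T x \<omega>} \<omega> \<partial>P)"
    by (rule nn_integral_cmult) measurable
  finally show ?thesis .
qed

subsection \<open>Khasminskii's estimate\<close>

text \<open>At the smallest time \<open>u\<close>, the factor \<open>killed f x u\<close> joins the
  weight, which becomes \<open>F u\<close>-measurable. The induction hypothesis from
  \<open>u\<close> on gives \<open>\<alpha> ^ n\<close>, because \<open>t \<le> u + h\<close> still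
  holds. The integral left over \<open>u\<close> is a first moment and gives the last factor
  \<alpha>.\<close>

lemma khasminskii_moments:
  assumes f: "f \<in> borel_measurable borel"
    and le: "\<And>y. (\<integral>\<^sup>+r\<in>{0..h}. semigroup f r y \<partial>lborel) \<le> \<alpha>"
    and "0 \<le> s" "t \<le> s + h" "Z \<in> borel_measurable (F s)"
  shows "(\<integral>\<^sup>+\<omega>. Z \<omega> * indicator {\<omega>. ennreal s < T x \<omega>} \<omega> * iterated_integral (\<lambda>u. killed f x u \<omega>) t n s \<partial>P) \<le>
    \<alpha> ^ n * (\<integral>\<^sup>+\<omega>. Z \<omega> * indicator {\<omega>. ennreal s < T x \<omega>} \<omega> \<partial>P)"
  using assms(3-5)
proof (induction n arbitrary: s Z)
  case (Suc n)
  interpret L: pair_sigma_finite lborel P ..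
  note s = Suc.prems(1)
  note [measurable] = f measurable_killed_pair[OF f] measurable_iterated_integral_pair[OF measurable_killed_pair[OF f]]
  define W where "W \<omega> = Z \<omega> * indicator {\<omega>. ennreal s < T x \<omega>} \<omega>" for \<omega>
  have W: "W \<in> borel_measurable (F s)"
    using pred_alive[OF s, of x] Suc.prems(3) unfolding W_def by measurable
  note [measurable] = measurable_F_P[OF s W]
  have "(\<integral>\<^sup>+\<omega>. W \<omega> * iterated_integral (\<lambda>u. killed f x u \<omega>) t (Suc n) s \<partial>P) =
    (\<integral>\<^sup>+\<omega>. \<integral>\<^sup>+u. W \<omega> * (killed f x u \<omega> * iterated_integral (\<lambda>u. killed f x u \<omega>) t n u) * indicator {s..t} u \<partial>lborel \<partial>P)"
    by (intro nn_integral_cong) (simp add: nn_integral_cmult mult.assoc)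
  also have "\<dots> = (\<integral>\<^sup>+u. \<integral>\<^sup>+\<omega>. W \<omega> * (killed f x u \<omega> * iterated_integral (\<lambda>u. killed f x u \<omega>) t n u) * indicator {s..t} u \<partial>P \<partial>lborel)"
    by (rule L.Fubini') measurable
  also have "\<dots> \<le> (\<integral>\<^sup>+u. \<integral>\<^sup>+\<omega>. \<alpha> ^ n * (W \<omega> * killed f x u \<omega> * indicator {s..t} u) \<partial>P \<partial>lborel)"
  proof (rule nn_integral_mono)
    fix u
    show "(\<integral>\<^sup>+\<omega>. W \<omega> * (killed f x u \<omega> * iterated_integral (\<lambda>u. killed f x u \<omega>) t n u) * indicator {s..t} u \<partial>P)
      \<le> (\<integral>\<^sup>+\<omega>. \<alpha> ^ n * (W \<omega> * killed f x u \<omega> * indicator {s..t} u) \<partial>P)"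
    proof (cases "u \<in> {s..t}")
      case True
      \<comment> \<open>The indicator of being alive at \<open>u\<close>, which the induction
        hypothesis carries, is already contained in \<open>killed f x u\<close>.\<close>
      have k: "killed f x u \<omega> * indicator {\<omega>. ennreal u < T x \<omega>} \<omega> = killed f x u \<omega>" for \<omega>
        by (auto simp: killed_def)
      have "(\<lambda>\<omega>. W \<omega> * killed f x u \<omega>) \<in> borel_measurable (F u)"
        using True s by (intro borel_measurable_times_ennreal measurable_F_mono[OF _ _ W] measurable_killed f) auto
      from Suc.IH[OF _ _ this] True s Suc.prems(2)
      have "(\<integral>\<^sup>+\<omega>. W \<omega> * killed f x u \<omega> * indicator {\<omega>. ennreal u < T x \<omega>} \<omega> *
          iterated_integral (\<lambda>u. killed f x u \<omega>) t n u \<partial>P)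
        \<le> \<alpha> ^ n * (\<integral>\<^sup>+\<omega>. W \<omega> * killed f x u \<omega> * indicator {\<omega>. ennreal u < T x \<omega>} \<omega> \<partial>P)"
        by auto
      then show ?thesis
        using True measurable_killed_P[OF f, of x u]
        by (simp add: mult.assoc k nn_integral_cmult)
    qed simp
  qed
  also have "\<dots> = (\<integral>\<^sup>+\<omega>. \<integral>\<^sup>+u. \<alpha> ^ n * (W \<omega> * killed f x u \<omega> * indicator {s..t} u) \<partial>lborel \<partial>P)"
    by (rule L.Fubini'[symmetric]) measurable
  also have "\<dots> = (\<integral>\<^sup>+\<omega>. \<alpha> ^ n * (W \<omega> * (\<integral>\<^sup>+u\<in>{s..t}. killed f x u \<omega> \<partial>lborel)) \<partial>P)"
    by (intro nn_integral_cong) (simp add: nn_integral_cmult mult.assoc)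
  also have "\<dots> \<le> (\<integral>\<^sup>+\<omega>. \<alpha> ^ n * (W \<omega> * (\<integral>\<^sup>+u\<in>{s..s+h}. killed f x u \<omega> \<partial>lborel)) \<partial>P)"
    using Suc.prems(2) by (intro nn_integral_mono mult_left_mono) (auto simp: indicator_def)
  also have "\<dots> = \<alpha> ^ n * (\<integral>\<^sup>+\<omega>. W \<omega> * (\<integral>\<^sup>+u\<in>{s..s+h}. killed f x u \<omega> \<partial>lborel) \<partial>P)"
    by (rule nn_integral_cmult) measurable
  also have "\<dots> \<le> \<alpha> ^ n * (\<alpha> * (\<integral>\<^sup>+\<omega>. W \<omega> * indicator {\<omega>. ennreal s < T x \<omega>} \<omega> \<partial>P))"
    by (intro mult_left_mono khasminskii_first_moment f s W le) simp
  also have "\<dots> = \<alpha> ^ Suc n * (\<integral>\<^sup>+\<omega>. W \<omega> \<partial>P)"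
    by (simp add: W_def mult.assoc mult.left_commute indicator_inter_arith[symmetric])
  finally show ?case unfolding W_def .
qed simp

lemma khasminskii:
  assumes f: "f \<in> borel_measurable borel"
    and le: "\<And>y. (\<integral>\<^sup>+r\<in>{0..h}. semigroup f r y \<partial>lborel) \<le> ennreal a"
    and a: "0 \<le> a" "a < 1"
    and st: "0 \<le> s" "s \<le> t" "t \<le> s + h" and Z: "Z \<in> borel_measurable (F s)"
  shows "(\<integral>\<^sup>+\<omega>. Z \<omega> * indicator {\<omega>. ennreal s < T x \<omega>} \<omega> * exp_ennreal (\<integral>\<^sup>+u\<in>{s..t}. killed f x u \<omega> \<partial>lborel) \<partial>P) \<le>
    ennreal (1 / (1 - a)) * (\<integral>\<^sup>+\<omega>. Z \<omega> * indicator {\<omega>. ennreal s < T x \<omega>} \<omega> \<partial>P)"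
proof -
  note [measurable] = f measurable_killed_pair[OF f] measurable_iterated_integral_pair[OF measurable_killed_pair[OF f]]
    measurable_F_P[OF st(1) Z] measurable_F_P[OF st(1) pred_alive[OF st(1)]]
  let ?W = "\<lambda>\<omega>. Z \<omega> * indicator {\<omega>. ennreal s < T x \<omega>} \<omega>"
  have "(\<integral>\<^sup>+\<omega>. ?W \<omega> * exp_ennreal (\<integral>\<^sup>+u\<in>{s..t}. killed f x u \<omega> \<partial>lborel) \<partial>P) \<le>
     (\<integral>\<^sup>+\<omega>. ?W \<omega> * (\<Sum>n. iterated_integral (\<lambda>u. killed f x u \<omega>) t n s) \<partial>P)"
    by (intro nn_integral_mono mult_left_mono exp_ennreal_le_iterated_integral_series st) measurable
  also have "\<dots> = (\<integral>\<^sup>+\<omega>. (\<Sum>n. ?W \<omega> * iterated_integral (\<lambda>u. killed f x u \<omega>) t n s) \<partial>P)"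
    by (simp only: ennreal_suminf_cmult)
  also have "\<dots> = (\<Sum>n. \<integral>\<^sup>+\<omega>. ?W \<omega> * iterated_integral (\<lambda>u. killed f x u \<omega>) t n s \<partial>P)"
    by (rule nn_integral_suminf) measurable
  also have "\<dots> \<le> (\<Sum>n. ennreal a ^ n * (\<integral>\<^sup>+\<omega>. ?W \<omega> \<partial>P))"
    by (intro suminf_le khasminskii_moments[where h=h] f le st Z) auto
  also have "\<dots> = (\<Sum>n. ennreal (a ^ n)) * (\<integral>\<^sup>+\<omega>. ?W \<omega> \<partial>P)"
    using a by (simp only: ennreal_suminf_multc ennreal_power)
  also have "(\<Sum>n. ennreal (a ^ n)) = ennreal (1 / (1 - a))"
    using a geometric_sums[of a] by (intro suminf_ennreal_eq) auto
  finally show ?thesis .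
qed

text \<open>Measurability in \<open>F s\<close>, and not merely in \<open>P\<close>, admits this
  exponential as the weight \<open>Z\<close> in \<open>khasminskii\<close>. It rests on progressive
  measurability over \<open>{0..s}\<close>.\<close>

lemma measurable_exp_additive_functional:
  assumes f: "f \<in> borel_measurable borel" and s: "0 \<le> s"
  shows "(\<lambda>\<omega>. exp_ennreal (\<integral>\<^sup>+u\<in>{0..s}. killed f x u \<omega> \<partial>lborel)) \<in> borel_measurable (F s)"
proof -
  note [measurable] = measurable_killed_progressive[OF s f, of x]
  have "(\<lambda>\<omega>. exp_ennreal (\<integral>\<^sup>+u. (\<lambda>(u, \<omega>). killed f x u \<omega> * indicator {..s} u) (u, \<omega>) * indicator {0..} u \<partial>lborel))
      \<in> borel_measurable (F s)"
    by measurable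
  also have "(\<lambda>\<omega>. exp_ennreal (\<integral>\<^sup>+u. (\<lambda>(u, \<omega>). killed f x u \<omega> * indicator {..s} u) (u, \<omega>) * indicator {0..} u \<partial>lborel)) =
      (\<lambda>\<omega>. exp_ennreal (\<integral>\<^sup>+u\<in>{0..s}. killed f x u \<omega> \<partial>lborel))"
    by (intro ext arg_cong[where f=exp_ennreal] nn_integral_cong) (auto simp: indicator_def)
  finally show ?thesis .
qed

text \<open>The last span is split off: the exponential collected up to its left end
  \<open>s\<close> is the weight, \<open>khasminskii\<close> contributes one factor, and the
  induction hypothesis bounds the rest.\<close>

lemma exponential_moment_power_bound:
  assumes f: "f \<in> borel_measurable borel"
    and le: "\<And>y. (\<integral>\<^sup>+r\<in>{0..h}. semigroup f r y \<partial>lborel) \<le> ennreal a"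
    and a: "0 \<le> a" "a < 1" and h: "0 < h"
    and "0 \<le> t" "t \<le> real n * h"
  shows "(\<integral>\<^sup>+\<omega>. exp_ennreal (\<integral>\<^sup>+u\<in>{0..t}. killed f x u \<omega> \<partial>lborel) * indicator {\<omega>. ennreal t < T x \<omega>} \<omega> \<partial>P)
    \<le> ennreal (1 / (1 - a)) ^ n"
  using assms(6,7)
proof (induction n arbitrary: t)
  case 0
  then have "t = 0" by simp
  have "(\<integral>\<^sup>+u\<in>{0..0::real}. killed f x u \<omega> \<partial>lborel) = (\<integral>\<^sup>+u. 0 \<partial>(lborel :: real measure))" for \<omega>
    using AE_lborel_singleton[of "0::real"] by (intro nn_integral_cong_AE) auto
  then have "(\<integral>\<^sup>+\<omega>. exp_ennreal (\<integral>\<^sup>+u\<in>{0..t}. killed f x u \<omega> \<partial>lborel) * indicator {\<omega>. ennreal t < T x \<omega>} \<omega> \<partial>P)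
     \<le> (\<integral>\<^sup>+\<omega>. 1 \<partial>P)"
    unfolding \<open>t = 0\<close> by (intro nn_integral_mono) (auto simp: indicator_def)
  then show ?case by (simp add: emeasure_space_1)
next
  case (Suc n)
  \<comment> \<open>The maximum covers the case in which \<open>t\<close> is shorter than one
    span.\<close>
  define s where "s = max 0 (t - h)"
  have s: "0 \<le> s" "s \<le> t" "t \<le> s + h" "s \<le> real n * h"
    using Suc.prems h by (auto simp: s_def algebra_simps)
  note [measurable] = f measurable_killed_pair[OF f]
  let ?Z = "\<lambda>\<omega>. exp_ennreal (\<integral>\<^sup>+u\<in>{0..s}. killed f x u \<omega> \<partial>lborel)"
  have "(\<integral>\<^sup>+\<omega>. exp_ennreal (\<integral>\<^sup>+u\<in>{0..t}. killed f x u \<omega> \<partial>lborel) * indicator {\<omega>. ennreal t < T x \<omega>} \<omega> \<partial>P)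
    \<le> (\<integral>\<^sup>+\<omega>. ?Z \<omega> * indicator {\<omega>. ennreal s < T x \<omega>} \<omega> *
         exp_ennreal (\<integral>\<^sup>+u\<in>{s..t}. killed f x u \<omega> \<partial>lborel) \<partial>P)"
  proof (rule nn_integral_mono)
    fix \<omega> assume [measurable]: "\<omega> \<in> space P"
    have "(\<integral>\<^sup>+u\<in>{0..t}. killed f x u \<omega> \<partial>lborel) \<le>
        (\<integral>\<^sup>+u. killed f x u \<omega> * indicator {0..s} u + killed f x u \<omega> * indicator {s..t} u \<partial>lborel)"
      by (intro nn_integral_mono) (auto simp: indicator_def)
    also have "\<dots> = (\<integral>\<^sup>+u\<in>{0..s}. killed f x u \<omega> \<partial>lborel) + (\<integral>\<^sup>+u\<in>{s..t}. killed f x u \<omega> \<partial>lborel)"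
      by (rule nn_integral_add) measurable
    finally have "exp_ennreal (\<integral>\<^sup>+u\<in>{0..t}. killed f x u \<omega> \<partial>lborel) \<le>
       ?Z \<omega> * exp_ennreal (\<integral>\<^sup>+u\<in>{s..t}. killed f x u \<omega> \<partial>lborel)"
      unfolding exp_ennreal_add[symmetric] by (rule exp_ennreal_mono)
    \<comment> \<open>Being alive at \<open>t\<close> is weakened to being alive at
      \<open>s\<close>, the event that the estimate over the last span carries.\<close>
    moreover have "ennreal s < T x \<omega>" if "ennreal t < T x \<omega>"
      using that s ennreal_leI le_less_trans by blast
    ultimately show "exp_ennreal (\<integral>\<^sup>+u\<in>{0..t}. killed f x u \<omega> \<partial>lborel) * indicator {\<omega>. ennreal t < T x \<omega>} \<omega>
      \<le> ?Z \<omega> * indicator {\<omega>. ennreal s < T x \<omega>} \<omega> *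
         exp_ennreal (\<integral>\<^sup>+u\<in>{s..t}. killed f x u \<omega> \<partial>lborel)"
      by (auto simp: indicator_def)
  qed
  also have "\<dots> \<le> ennreal (1 / (1 - a)) * (\<integral>\<^sup>+\<omega>. ?Z \<omega> * indicator {\<omega>. ennreal s < T x \<omega>} \<omega> \<partial>P)"
    by (intro khasminskii[where h=h] f le a s measurable_exp_additive_functional)
  also have "\<dots> \<le> ennreal (1 / (1 - a)) * ennreal (1 / (1 - a)) ^ n"
    by (intro mult_left_mono Suc.IH s) simp
  finally show ?case by simp
qed

lemma exponential_moment_bound:
  assumes f: "f \<in> borel_measurable borel"
    and le: "\<And>y. (\<integral>\<^sup>+r\<in>{0..h}. semigroup f r y \<partial>lborel) \<le> ennreal (1 - 1 / \<delta>)"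
    and \<delta>: "1 < \<delta>" and h: "0 < h" and t: "0 \<le> t"
  shows "(\<integral>\<^sup>+\<omega>. exp_ennreal (\<integral>\<^sup>+u\<in>{0..t}. killed f x u \<omega> \<partial>lborel) * indicator {\<omega>. ennreal t < T x \<omega>} \<omega> \<partial>P)
    \<le> ennreal (\<delta> * exp (t * (ln \<delta> / h)))"
proof -
  \<comment> \<open>Rounding \<open>t / h\<close> up costs at most one additional span, whose factor
    \<delta> is the prefactor of the final bound.\<close>
  define n where "n = nat \<lceil>t / h\<rceil>"
  have "0 \<le> t / h" using t h by simp
  then have n: "t / h \<le> real n" "real n \<le> t / h + 1" unfolding n_def by linarith+
  have "(\<integral>\<^sup>+\<omega>. exp_ennreal (\<integral>\<^sup>+u\<in>{0..t}. killed f x u \<omega> \<partial>lborel) * indicator {\<omega>. ennreal t < T x \<omega>} \<omega> \<partial>P)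
    \<le> ennreal (1 / (1 - (1 - 1 / \<delta>))) ^ n"
    using n h t \<delta> by (intro exponential_moment_power_bound[OF f le]) (auto simp: field_simps)
  also have "\<dots> = ennreal (\<delta> ^ n)" using \<delta> by (simp add: ennreal_power)
  also have "\<delta> ^ n = exp (real n * ln \<delta>)" using \<delta> by (simp add: exp_of_nat_mult)
  also have "\<dots> \<le> exp ((t / h + 1) * ln \<delta>)"
    using n \<delta> by (intro iffD2[OF exp_le_cancel_iff] mult_right_mono) auto
  also have "\<dots> = \<delta> * exp (t * (ln \<delta> / h))"
    using \<delta> by (simp add: algebra_simps exp_add)
  finally show ?thesis by (simp add: ennreal_leI)
qed

end

section \<open>Brownian motion as a killed Markov family\<close>

theorem lemma3p8:
  fixes A :: "('a::{t2_space, second_countable_topology}, 'n::finite) chart set"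
    and g :: "('a, 'n) metric_tensor"
    and vol :: "'a measure"
    and p :: "real \<Rightarrow> 'a \<Rightarrow> 'a \<Rightarrow> real"
    and P :: "'w measure"
    and F :: "ennreal \<Rightarrow> 'w measure"
    and B :: "'a \<Rightarrow> real \<Rightarrow> 'w \<Rightarrow> 'a"
    and \<zeta> :: "'a \<Rightarrow> 'w \<Rightarrow> ennreal"
    and v :: "'a \<Rightarrow> complex"
    and \<delta> :: real
  assumes "riemannian_manifold A g"
    and "connected (UNIV :: 'a set)"
    and "riemannian_volume A g vol"
    and "minimal_heat_kernel A g vol p"
    and "usual_filtered_prob_space P F"
    and "\<And>x. brownian_motion vol p P F x (B x) (\<zeta> x)"
    and "v \<in> kato_class vol p"
    and "\<delta> > 1"
  shows "\<exists>C>0. \<forall>t\<ge>0.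
           (SUP x. \<integral>\<^sup>+ \<omega>. exp_ennreal (\<integral>\<^sup>+ s\<in>{0..t}. ennreal (cmod (v (B x s \<omega>))) \<partial>lborel) *
                     indicator {\<omega>. ennreal t < \<zeta> x \<omega>} \<omega> \<partial>P)
           \<le> ennreal (\<delta> * exp (t * C))"
proof -
  interpret prob_space P using assms(5) by (simp add: usual_filtered_prob_space_def)
  interpret P: complete_measure P using assms(5) by (simp add: usual_filtered_prob_space_def)
  have filt: "filtration (space P) F" "\<And>t. sets (F t) \<subseteq> sets P" "null_sets P \<subseteq> sets (F 0)"
    using assms(5) by (auto simp: usual_filtered_prob_space_def)
  interpret filt: filtration "space P" F by (rule filt)
  have sub: "subalgebra P (F t)" for t
    using filt.space_F filt(2) by (auto simp: subalgebra_def)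
  define good where "good x \<omega> \<longleftrightarrow> continuous_on {t. 0 \<le> t \<and> ennreal t < \<zeta> x \<omega>} (\<lambda>t. B x t \<omega>)" for x \<omega>
  \<comment> \<open>killing the discontinuous paths at once makes continuity hold everywhere\<close>
  define T where "T x \<omega> = (if good x \<omega> then \<zeta> x \<omega> else 0)" for x \<omega>
  have ad: "{\<omega>\<in>space P. ennreal t < \<zeta> x \<omega> \<and> B x t \<omega> \<in> N} \<in> sets (F (ennreal t))"
    if "0 \<le> t" "N \<in> sets borel" for x t N
    using assms(6)[of x] that unfolding brownian_motion_def by blast
  have good: "AE \<omega> in P. good x \<omega>" for x
    using assms(6)[of x] unfolding brownian_motion_def good_def by blast
  have start: "AE \<omega> in P. 0 < \<zeta> x \<omega> \<and> B x 0 \<omega> = x" for x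
    using assms(6)[of x] unfolding brownian_motion_def by blast
  have mk: "AE \<omega> in P. nn_cond_exp P (F (ennreal s))
        (indicator {\<omega>\<in>space P. ennreal (s + t) < \<zeta> x \<omega> \<and> B x (s + t) \<omega> \<in> N}) \<omega> =
      indicator {\<omega>. ennreal s < \<zeta> x \<omega>} \<omega> * (\<integral>\<^sup>+ y\<in>N. ennreal (p t (B x s \<omega>) y) \<partial>vol)"
    if "0 \<le> s" "0 < t" "N \<in> sets borel" for x s t N
    using assms(6)[of x] that unfolding brownian_motion_def by blast
  let ?D = "\<lambda>x t N. {\<omega>\<in>space P. ennreal t < T x \<omega> \<and> B x t \<omega> \<in> N}"
  have adT: "?D x t N \<in> sets (F (ennreal t))" if "0 \<le> t" "N \<in> sets borel" for x t N
  proof -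
    \<comment> \<open>The usual conditions place null sets in \<open>F 0\<close>, so killing the
      exceptional paths at time 0 preserves adaptedness.\<close>
    have "{\<omega>\<in>space P. \<not> good x \<omega>} \<in> null_sets P" using good P.AE_iff_null_sets by blast
    then have "{\<omega>\<in>space P. \<not> good x \<omega>} \<in> sets (F (ennreal t))"
      using filt(3) filt.sets_F_mono[of 0 "ennreal t"] by auto
    from sets.Diff[OF ad[OF that, of x] this]
    show ?thesis by (rule back_subst[of "\<lambda>A. A \<in> sets _"]) (auto simp: T_def split: if_split_asm)
  qed
  have DP: "?D x t N \<in> sets P" if "0 \<le> t" "N \<in> sets borel" for x t N
    using adT[OF that] filt(2) by blast
  have mkT: "AE \<omega> in P. nn_cond_exp P (F (ennreal s)) (indicator (?D x (s + t) N)) \<omega> =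
      indicator {\<omega>. ennreal s < T x \<omega>} \<omega> * (\<integral>\<^sup>+ y\<in>N. ennreal (p t (B x s \<omega>) y) \<partial>vol)"
    if st: "0 \<le> s" "0 < t" "N \<in> sets borel" for x s t N
  proof -
    interpret finite_measure_subalgebra P "F (ennreal s)" by unfold_locales (rule sub)
    have "AE \<omega> in P. nn_cond_exp P (F (ennreal s)) (indicator (?D x (s + t) N)) \<omega> =
      nn_cond_exp P (F (ennreal s)) (indicator {\<omega>\<in>space P. ennreal (s + t) < \<zeta> x \<omega> \<and> B x (s + t) \<omega> \<in> N}) \<omega>"
    proof (rule nn_cond_exp_cong)
      show "AE \<omega> in P. indicator (?D x (s + t) N) \<omega> =
          (indicator {\<omega>\<in>space P. ennreal (s + t) < \<zeta> x \<omega> \<and> B x (s + t) \<omega> \<in> N} \<omega> :: ennreal)"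
        using good[of x] by eventually_elim (auto simp: T_def indicator_def)
      show "indicator (?D x (s + t) N) \<in> borel_measurable P"
        using DP[of "s + t" N x] st by simp
      show "indicator {\<omega>\<in>space P. ennreal (s + t) < \<zeta> x \<omega> \<and> B x (s + t) \<omega> \<in> N} \<in> borel_measurable P"
        using ad[of "s + t" N x] filt(2) st by (intro borel_measurable_indicator) auto
    qed
    with mk[OF st, of x] good[of x] show ?thesis
      by eventually_elim (simp add: T_def indicator_def)
  qed
  \<comment> \<open>This is the Markov property at time 0, where the path is almost surely alive at
    \<open>x\<close>, so that the kernel integral is constant in \<omega>. It lets the transition
    probabilities be rewritten as laws of the family.\<close>
  have kernel: "emeasure P (?D x t N) = (\<integral>\<^sup>+ y\<in>N. ennreal (p t x y) \<partial>vol)"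
    if t: "0 < t" and N: "N \<in> sets borel" for x t N
  proof -
    interpret finite_measure_subalgebra P "F (ennreal 0)" by unfold_locales (rule sub)
    have D: "?D x t N \<in> sets P" using t N by (intro DP) auto
    have "emeasure P (?D x t N) = (\<integral>\<^sup>+\<omega>. 1 * indicator (?D x t N) \<omega> \<partial>P)" using D by simp
    also have "\<dots> = (\<integral>\<^sup>+\<omega>. 1 * nn_cond_exp P (F (ennreal 0)) (indicator (?D x t N)) \<omega> \<partial>P)"
      using D by (intro nn_cond_exp_intg[symmetric]) auto
    also have "\<dots> = (\<integral>\<^sup>+\<omega>. (\<integral>\<^sup>+ y\<in>N. ennreal (p t x y) \<partial>vol) \<partial>P)"
      using mkT[OF order_refl t N, of x] start[of x] good[of x]
      by (intro nn_integral_cong_AE, eventually_elim) (simp add: T_def)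
    finally show ?thesis by (simp add: emeasure_space_1)
  qed
  interpret K: killed_markov_family P "\<lambda>t. F (ennreal t)" B T
  proof
    show "subalgebra P (F (ennreal s))" for s by (rule sub)
    show "sets (F (ennreal s)) \<subseteq> sets (F (ennreal t))" if "s \<le> t" for s t
      using that by (intro filt.sets_F_mono ennreal_leI)
    show "?D x t N \<in> sets (F (ennreal t))" if "0 \<le> t" "N \<in> sets borel" for x t N
      using that by (rule adT)
    show "continuous_on {t. 0 \<le> t \<and> ennreal t < T x \<omega>} (\<lambda>t. B x t \<omega>)" for x \<omega>
      by (cases "good x \<omega>") (auto simp: T_def good_def)
    show "\<exists>V. open V \<and> y \<in> V \<and> closure V \<subseteq> U" if "open U" "y \<in> U" for U and y :: 'a
      using assms(1) that riemannian_manifold_regular[of A] by (auto simp: riemannian_manifold_def)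
    show "AE \<omega> in P. nn_cond_exp P (F (ennreal s)) (indicator (?D x (s + t) N)) \<omega> =
        indicator {\<omega>. ennreal s < T x \<omega>} \<omega> * emeasure P (?D (B x s \<omega>) t N)"
      if "0 \<le> s" "0 < t" "N \<in> sets borel" for s t N x
      using mkT[OF that] by (simp add: kernel that)
  qed
  define f where "f y = ennreal (cmod (v y))" for y
  have v: "v \<in> borel_measurable borel"
    and kato: "((\<lambda>t. SUP x. \<integral>\<^sup>+ s\<in>{0..t}. (\<integral>\<^sup>+ y. ennreal (p s x y) * f y \<partial>vol) \<partial>lborel) \<longlongrightarrow> 0) (at_right 0)"
    using assms(7) by (auto simp: kato_class_def f_def)
  have f: "f \<in> borel_measurable borel" using v unfolding f_def by measurable
  \<comment> \<open>Equality holds for indicators. For sums and scalar multiples the right side is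
    only a lower integral, so one direction survives; it is the one that transfers the Kato bound to
    the semigroup.\<close>
  have semigroup_le: "K.semigroup k r x \<le> (\<integral>\<^sup>+ y. ennreal (p r x y) * k y \<partial>vol)"
    if k: "k \<in> borel_measurable borel" and r: "0 < r" for k r x
    using k
  proof (induction k rule: borel_measurable_induct)
    case (cong k l)
    then have "k = l" by auto
    then show ?case using cong by simp
  next
    case (set N)
    then show ?case using r by (simp add: K.semigroup_indicator kernel)
  next
    case (mult u c)
    have "c * K.semigroup u r x \<le> c * (\<integral>\<^sup>+ y. ennreal (p r x y) * u y \<partial>vol)"
      by (intro mult_left_mono mult.IH) simp
    also have "\<dots> \<le> (\<integral>\<^sup>+ y. c * (ennreal (p r x y) * u y) \<partial>vol)"
      by (rule nn_integral_cmult_le) (rule mult.hyps(1))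
    finally show ?case by (simp add: K.semigroup_cmult mult.hyps mult.left_commute)
  next
    case (add u w)
    have "K.semigroup w r x + K.semigroup u r x \<le>
        (\<integral>\<^sup>+ y. ennreal (p r x y) * w y \<partial>vol) + (\<integral>\<^sup>+ y. ennreal (p r x y) * u y \<partial>vol)"
      by (intro add_mono add.IH)
    also have "\<dots> \<le> (\<integral>\<^sup>+ y. ennreal (p r x y) * w y + ennreal (p r x y) * u y \<partial>vol)"
      by (rule nn_integral_superadd)
    finally show ?case by (simp add: K.semigroup_add add.hyps distrib_left)
  next
    case (seq U)
    have "K.semigroup (U i) r x \<le> (\<integral>\<^sup>+ y. ennreal (p r x y) * (SUP i. U i) y \<partial>vol)" for i
      by (rule order_trans[OF seq.IH])
         (intro nn_integral_mono mult_left_mono le_funD[OF SUP_upper] UNIV_I zero_le)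
    then show ?case unfolding K.semigroup_SUP[OF seq.hyps(1,3)] by (rule SUP_least)
  qed
  have "\<forall>\<^sub>F t in at_right 0. (SUP x. \<integral>\<^sup>+ s\<in>{0..t}. (\<integral>\<^sup>+ y. ennreal (p s x y) * f y \<partial>vol) \<partial>lborel) < ennreal (1 - 1 / \<delta>)"
    using assms(8) by (intro order_tendstoD(2)[OF kato]) auto
  then obtain b :: real where b: "0 < b" "\<And>t. 0 < t \<Longrightarrow> t < b \<Longrightarrow>
      (SUP x. \<integral>\<^sup>+ s\<in>{0..t}. (\<integral>\<^sup>+ y. ennreal (p s x y) * f y \<partial>vol) \<partial>lborel) < ennreal (1 - 1 / \<delta>)"
    unfolding eventually_at_right_field by auto
  define h where "h = b / 2"
  have h: "0 < h" "h < b" using b(1) by (auto simp: h_def)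
  have le: "(\<integral>\<^sup>+r\<in>{0..h}. K.semigroup f r x \<partial>lborel) \<le> ennreal (1 - 1 / \<delta>)" for x
  proof -
    have "(\<integral>\<^sup>+r\<in>{0..h}. K.semigroup f r x \<partial>lborel) \<le>
        (\<integral>\<^sup>+ s\<in>{0..h}. (\<integral>\<^sup>+ y. ennreal (p s x y) * f y \<partial>vol) \<partial>lborel)"
      \<comment> \<open>\<open>semigroup_le\<close> covers positive times; the time 0 is a null
        set.\<close>
      using AE_lborel_singleton[of 0]
      by (intro nn_integral_mono_AE, eventually_elim) (auto simp: indicator_def intro!: semigroup_le f)
    also have "\<dots> \<le> (SUP x. \<integral>\<^sup>+ s\<in>{0..h}. (\<integral>\<^sup>+ y. ennreal (p s x y) * f y \<partial>vol) \<partial>lborel)"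
      by (rule SUP_upper) simp
    also have "\<dots> \<le> ennreal (1 - 1 / \<delta>)" using b(2)[OF h] by (rule less_imp_le)
    finally show ?thesis .
  qed
  show ?thesis
  proof (intro exI[of _ "ln \<delta> / h"] conjI allI impI SUP_least)
    show "0 < ln \<delta> / h" using h assms(8) by simp
    fix t :: real and x assume t: "0 \<le> t"
    have "(\<integral>\<^sup>+ \<omega>. exp_ennreal (\<integral>\<^sup>+ s\<in>{0..t}. ennreal (cmod (v (B x s \<omega>))) \<partial>lborel) *
            indicator {\<omega>. ennreal t < \<zeta> x \<omega>} \<omega> \<partial>P) =
        (\<integral>\<^sup>+\<omega>. exp_ennreal (\<integral>\<^sup>+u\<in>{0..t}. K.killed f x u \<omega> \<partial>lborel) * indicator {\<omega>. ennreal t < T x \<omega>} \<omega> \<partial>P)"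
    proof (rule nn_integral_cong_AE)
      show "AE \<omega> in P. exp_ennreal (\<integral>\<^sup>+ s\<in>{0..t}. ennreal (cmod (v (B x s \<omega>))) \<partial>lborel) *
            indicator {\<omega>. ennreal t < \<zeta> x \<omega>} \<omega> =
          exp_ennreal (\<integral>\<^sup>+u\<in>{0..t}. K.killed f x u \<omega> \<partial>lborel) * indicator {\<omega>. ennreal t < T x \<omega>} \<omega>"
        using good[of x]
      proof eventually_elim
        case (elim \<omega>)
        show ?case
        proof (cases "ennreal t < \<zeta> x \<omega>")
          case True
          \<comment> \<open>A path alive at \<open>t\<close> is alive throughout
            \<open>{0..t}\<close>, so there the extension by 0 is invisible. Otherwise both
            indicators vanish.\<close>
          have "ennreal u < \<zeta> x \<omega>" if "u \<le> t" for u
            using True ennreal_leI[OF that] by (rule le_less_trans[rotated])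
          then have "(\<integral>\<^sup>+ s\<in>{0..t}. ennreal (cmod (v (B x s \<omega>))) \<partial>lborel) =
              (\<integral>\<^sup>+u\<in>{0..t}. K.killed f x u \<omega> \<partial>lborel)"
            using elim by (intro nn_integral_cong) (auto simp: K.killed_def T_def f_def indicator_def)
          then show ?thesis using elim by (simp add: T_def indicator_def)
        qed (use elim in \<open>simp add: T_def indicator_def\<close>)
      qed
    qed
    also have "\<dots> \<le> ennreal (\<delta> * exp (t * (ln \<delta> / h)))"
      by (rule K.exponential_moment_bound[OF f le assms(8) h(1) t])
    finally show "(\<integral>\<^sup>+ \<omega>. exp_ennreal (\<integral>\<^sup>+ s\<in>{0..t}. ennreal (cmod (v (B x s \<omega>))) \<partial>lborel) *
        indicator {\<omega>. ennreal t < \<zeta> x \<omega>} \<omega> \<partial>P) \<le> ennreal (\<delta> * exp (t * (ln \<delta> / h)))" .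
  qed
qed

end
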